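(* Let $f_0\in H_3^2\cup H_3^3$. Then, in coordinates in which the local map $T_0$ takes the second-order normal form, the value of $$s_0=dx^+(ac+f_{20}x^+)+\tfrac12f_{11}x^+\left(1+\nu_1-\tfrac12f_{11}x^+\right)$$ (for either of the two values $\nu_1=\pm1$) does not depend on the choice of the pair $(M^+,M^-)$ of homoclinic points of $\Gamma_0$ of the needed type.
   Context: Setting. $f_0$ is a $C^r$-smooth ($r\ge3$, and $r$ large enough that the second-order normal-form coordinates below exist) area-preserving map of a surface (Jacobian $\pm1$) such that: $f_0$ has a saddle fixed (or periodic) point $O$ with multipliers $\lambda,\gamma$, $0<|\lambda|<1<|\gamma|$, $|\lambda\gamma|=1$; the stable and unstable manifolds of $O$ have a quadratic tangency at the points of a homoclinic orbit $\Gamma_0$. $U_0$ is a small disk containing $O$. Local map: $T_0=f_0|_{U_0}$; second-order normal form in the case $\lambda\gamma=-1$: $\bar x=\lambda x(1+\beta_2(xy)^2)+O[|x|^3|y|^2(|x|+|y|)]$, $\bar y=\gamma y(1-\beta_2(xy)^2)+O[|x|^2|y|^3(|x|+|y|)]$. For a pair of points $M^+=(x^+,0)\in W^s_{loc}$ and $M^-=(0,y^-)\in W^u_{loc}$ of $\Gamma_0$ in $U_0$ with $f_0^q(M^-)=M^+$ (coordinates normalised by sign changes so that $x^+>0$, $y^->0$), the global map is $T_1=f_0^q$ from a small neighbourhood of $M^-$ to a small neighbourhood of $M^+$, written as $\bar x-x^+=ax+b(y-y^-)+e_{20}x^2+e_{11}x(y-y^-)+e_{02}(y-y^-)^2+\dots$,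 $\bar y=cx+d(y-y^-)^2+f_{20}x^2+f_{11}x(y-y^-)+\dots$, with $d\ne0$, $|bc|=1$. A pair $(M^+,M^-)$ is of the needed type if the corresponding map $T_1$ is orientable ($bc=-1$). (If $(M^+,M^-)$ is of the needed type then so are, e.g., $(T_0^2(M^+),M^-)$, $(M^+,T_0^{-2}(M^-))$ and $(T_0(M^+),T_0^{-1}(M^-))$, while $(T_0(M^+),M^-)$ and $(M^+,T_0^{-1}(M^-))$ are not.) $H_3^2$: $\lambda=-\gamma^{-1}<0$, $d<0$ ($c$ of either sign); $H_3^3$: $\lambda=-\gamma^{-1}<0$, $d>0$ ($c$ of either sign). In the paper $\nu_1=\mathrm{sign}(-bc\,\lambda^k\gamma^k)$, i.e. for pairs of the needed type $\nu_1=+1$ for even $k$ and $\nu_1=-1$ for odd $k$, where $k$ is the index of the first return map $T_k=T_1T_0^k$; the value of $\nu_1$ is the same for all pairs compared. *)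

theory Defs
  imports "HOL-Analysis.Analysis" "HOL-Library.Landau_Symbols"
begin

text \<open>On an open set, \<open>Ck_on k f S\<close> says that \<open>f\<close> is of class \<open>C^k\<close> on \<open>S\<close>.\<close>

primrec Ck_on :: "nat \<Rightarrow> ('a::real_normed_vector \<Rightarrow> 'b::real_normed_vector) \<Rightarrow> 'a set \<Rightarrow> bool" where
  "Ck_on 0 f S \<longleftrightarrow> continuous_on S f"
| "Ck_on (Suc k) f S \<longleftrightarrow>
     (\<forall>x\<in>S. f differentiable (at x)) \<and> (\<forall>v. Ck_on k (\<lambda>x. frechet_derivative f (at x) v) S)"

text \<open>A chart is its domain together with the coordinate function; the values of the
  coordinate function outside the domain carry no information.\<close>

type_synonym 'a chart = "'a set \<times> ('a \<Rightarrow> real^2)"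

definition is_chart :: "'a::topological_space chart \<Rightarrow> bool" where
  "is_chart c \<longleftrightarrow> open (fst c) \<and> open (snd c ` fst c) \<and>
     (\<exists>g. homeomorphism (fst c) (snd c ` fst c) (snd c) g)"

definition local_expr :: "'a chart \<Rightarrow> 'a chart \<Rightarrow> ('a \<Rightarrow> 'a) \<Rightarrow> real^2 \<Rightarrow> real^2" where
  "local_expr c c' f = snd c' \<circ> f \<circ> inv_into (fst c) (snd c)"

definition local_dom :: "'a chart \<Rightarrow> 'a chart \<Rightarrow> ('a \<Rightarrow> 'a) \<Rightarrow> (real^2) set" where
  "local_dom c c' f = snd c ` (fst c \<inter> f -` fst c')"

definition Ck_compatible :: "nat \<Rightarrow> 'a chart \<Rightarrow> 'a chart \<Rightarrow> bool" where
  "Ck_compatible k c c' \<longleftrightarrow>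
     Ck_on k (local_expr c c' id) (local_dom c c' id) \<and>
     Ck_on k (local_expr c' c id) (local_dom c' c id)"

definition Ck_atlas :: "nat \<Rightarrow> 'a::topological_space chart set \<Rightarrow> bool" where
  "Ck_atlas r A \<longleftrightarrow> (\<forall>c\<in>A. is_chart c) \<and> (\<Union>c\<in>A. fst c) = UNIV \<and>
     (\<forall>c\<in>A. \<forall>c'\<in>A. Ck_compatible r c c')"

text \<open>\<open>\<rho> c\<close> is the density of the area element with respect to \<open>dx dy\<close> in the chart \<open>c\<close>.\<close>

definition area_density :: "nat \<Rightarrow> 'a chart set \<Rightarrow> ('a chart \<Rightarrow> real^2 \<Rightarrow> real) \<Rightarrow> bool" where
  "area_density r A \<rho> \<longleftrightarrow>
     (\<forall>c\<in>A. Ck_on (r - 1) (\<rho> c) (snd c ` fst c) \<and> (\<forall>v\<in>snd c ` fst c. \<rho> c v > 0)) \<and>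
     (\<forall>c\<in>A. \<forall>c'\<in>A. \<forall>v\<in>local_dom c c' id.
        \<rho> c v = \<rho> c' (local_expr c c' id v) * \<bar>det (jacobian (local_expr c c' id) (at v))\<bar>)"

text \<open>The last condition says that the Jacobian with respect to the area element is \<open>\<plusminus>1\<close>. It makes
  \<open>f\<close> a local diffeomorphism, so together with bijectivity a \<open>C^r\<close> diffeomorphism.\<close>

definition area_preserving ::
  "nat \<Rightarrow> 'a::topological_space chart set \<Rightarrow> ('a chart \<Rightarrow> real^2 \<Rightarrow> real) \<Rightarrow> ('a \<Rightarrow> 'a) \<Rightarrow> bool" where
  "area_preserving r A \<rho> f \<longleftrightarrow>
     bij f \<and> continuous_on UNIV f \<and>
     (\<forall>c\<in>A. \<forall>c'\<in>A. Ck_on r (local_expr c c' f) (local_dom c c' f)) \<and>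
     (\<forall>c\<in>A. \<forall>c'\<in>A. \<forall>v\<in>local_dom c c' f.
        \<rho> c v = \<rho> c' (local_expr c c' f v) * \<bar>det (jacobian (local_expr c c' f) (at v))\<bar>)"

definition saddle_point ::
  "'a chart set \<Rightarrow> ('a \<Rightarrow> 'a) \<Rightarrow> nat \<Rightarrow> 'a \<Rightarrow> real \<Rightarrow> real \<Rightarrow> bool" where
  "saddle_point A f per z0 lam gam \<longleftrightarrow>
     per \<ge> 1 \<and> (f ^^ per) z0 = z0 \<and> (\<forall>k. 0 < k \<and> k < per \<longrightarrow> (f ^^ k) z0 \<noteq> z0) \<and>
     0 < \<bar>lam\<bar> \<and> \<bar>lam\<bar> < 1 \<and> 1 < \<bar>gam\<bar> \<and> \<bar>lam * gam\<bar> = 1 \<and>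
     (\<forall>c\<in>A. z0 \<in> fst c \<longrightarrow>
        (let J = jacobian (local_expr c c (f ^^ per)) (at (snd c z0)) in
          (\<exists>v. v \<noteq> 0 \<and> J *v v = lam *\<^sub>R v) \<and> (\<exists>v. v \<noteq> 0 \<and> J *v v = gam *\<^sub>R v)))"

definition stable_set :: "('a::topological_space \<Rightarrow> 'a) \<Rightarrow> 'a \<Rightarrow> 'a set" where
  "stable_set g z0 = {p. (\<lambda>k. (g ^^ k) p) \<longlonglongrightarrow> z0}"

abbreviation unstable_set :: "('a::topological_space \<Rightarrow> 'a) \<Rightarrow> 'a \<Rightarrow> 'a set" where
  "unstable_set g z0 \<equiv> stable_set (inv g) z0"

definition local_stable_set :: "('a::topological_space \<Rightarrow> 'a) \<Rightarrow> 'a \<Rightarrow> 'a set \<Rightarrow> 'a set" where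
  "local_stable_set g z0 U = {p \<in> stable_set g z0. \<forall>k. (g ^^ k) p \<in> U}"

abbreviation local_unstable_set :: "('a::topological_space \<Rightarrow> 'a) \<Rightarrow> 'a \<Rightarrow> 'a set \<Rightarrow> 'a set" where
  "local_unstable_set g z0 U \<equiv> local_stable_set (inv g) z0 U"

definition full_orbit :: "('a \<Rightarrow> 'a) \<Rightarrow> 'a \<Rightarrow> 'a set" where
  "full_orbit f p = range (\<lambda>k. (f ^^ k) p) \<union> range (\<lambda>k. (inv f ^^ k) p)"

text \<open>Regular \<open>C^2\<close> arcs in the two sets, parametrised with the same velocity \<open>v\<close> at \<open>p\<close>, have a
  tangency of exactly second order iff their accelerations differ by a vector that is not
  a multiple of \<open>v\<close>. This condition depends neither on the parametrisations nor on the chart.\<close>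

definition quadratic_tangency :: "'a chart set \<Rightarrow> 'a set \<Rightarrow> 'a set \<Rightarrow> 'a \<Rightarrow> bool" where
  "quadratic_tangency A W W' p \<longleftrightarrow>
     (\<exists>c\<in>A. \<exists>\<alpha> \<beta> :: real \<Rightarrow> 'a. \<exists>\<epsilon>>0. \<exists>v w w'.
        \<alpha> 0 = p \<and> \<beta> 0 = p \<and>
        \<alpha> ` {-\<epsilon><..<\<epsilon>} \<subseteq> W \<inter> fst c \<and> \<beta> ` {-\<epsilon><..<\<epsilon>} \<subseteq> W' \<inter> fst c \<and>
        Ck_on 2 (snd c \<circ> \<alpha>) {-\<epsilon><..<\<epsilon>} \<and> Ck_on 2 (snd c \<circ> \<beta>) {-\<epsilon><..<\<epsilon>} \<and>
        ((snd c \<circ> \<alpha>) has_vector_derivative v) (at 0) \<and>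
        ((snd c \<circ> \<beta>) has_vector_derivative v) (at 0) \<and>
        ((\<lambda>t. vector_derivative (snd c \<circ> \<alpha>) (at t)) has_vector_derivative w) (at 0) \<and>
        ((\<lambda>t. vector_derivative (snd c \<circ> \<beta>) (at t)) has_vector_derivative w') (at 0) \<and>
        v \<noteq> 0 \<and> (\<forall>k::real. w - w' \<noteq> k *\<^sub>R v))"

text \<open>For \<open>per > 1\<close> only every \<open>per\<close>-th point of the orbit lies on the invariant manifolds of \<open>z0\<close>
  itself; the others lie on those of its iterates, and there the tangency follows by applying \<open>f\<close>.\<close>

definition tangent_homoclinic_orbit ::
  "'a::topological_space chart set \<Rightarrow> ('a \<Rightarrow> 'a) \<Rightarrow> nat \<Rightarrow> 'a \<Rightarrow> 'a set \<Rightarrow> bool" where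
  "tangent_homoclinic_orbit A f per z0 \<Gamma> \<longleftrightarrow>
     (let Ws = stable_set (f ^^ per) z0; Wu = unstable_set (f ^^ per) z0 in
      (\<exists>p \<in> Ws \<inter> Wu. p \<noteq> z0 \<and> \<Gamma> = full_orbit f p) \<and>
      (\<forall>M \<in> \<Gamma> \<inter> Ws. quadratic_tangency A Wu Ws M))"

text \<open>The local map is \<open>f ^^ per\<close> restricted to the disk \<open>U0\<close>, so \<open>f\<close> itself at a fixed point.
  The remainder estimates are uniform on \<open>U0\<close>, in particular along the coordinate axes, where
  they force the local map to be linear. Class \<open>C^2\<close> is what the second-order expansion of the
  global map requires of the coordinates.\<close>

definition normal_form_coords ::
  "'a::topological_space chart set \<Rightarrow> ('a \<Rightarrow> 'a) \<Rightarrow> nat \<Rightarrow> 'a \<Rightarrow> real \<Rightarrow> real \<Rightarrow> 'a set \<Rightarrow> ('a \<Rightarrow> real^2) \<Rightarrow> bool" where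
  "normal_form_coords A f per z0 lam gam U0 \<phi> \<longleftrightarrow>
     is_chart (U0, \<phi>) \<and> (\<forall>c\<in>A. Ck_compatible 2 c (U0, \<phi>)) \<and>
     U0 homeomorphic ball (0::real^2) 1 \<and> z0 \<in> U0 \<and> \<phi> z0 = 0 \<and>
     (\<exists>\<beta>\<^sub>2 K. \<forall>v \<in> local_dom (U0, \<phi>) (U0, \<phi>) (f ^^ per).
        let x = v $ 1; y = v $ 2; w = local_expr (U0, \<phi>) (U0, \<phi>) (f ^^ per) v in
          \<bar>w $ 1 - lam * x * (1 + \<beta>\<^sub>2 * (x * y)^2)\<bar> \<le> K * (\<bar>x\<bar>^3 * \<bar>y\<bar>^2 * (\<bar>x\<bar> + \<bar>y\<bar>)) \<and>
          \<bar>w $ 2 - gam * y * (1 - \<beta>\<^sub>2 * (x * y)^2)\<bar> \<le> K * (\<bar>x\<bar>^2 * \<bar>y\<bar>^3 * (\<bar>x\<bar> + \<bar>y\<bar>)))"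

record global_coeffs =
  xp :: real  \<comment> \<open>first coordinate of \<open>M+\<close>\<close>
  ym :: real  \<comment> \<open>second coordinate of \<open>M-\<close>\<close>
  ca :: real
  cb :: real
  cc :: real
  cd :: real
  e20 :: real
  e11 :: real
  e02 :: real
  f20 :: real
  f11 :: real

definition sign_change :: "real \<Rightarrow> real \<Rightarrow> real^2 \<Rightarrow> real^2" where
  "sign_change \<sigma> \<tau> v = vector [\<sigma> * v $ 1, \<tau> * v $ 2]"

text \<open>The signs \<open>\<sigma>\<close>, \<open>\<tau>\<close> are chosen for each pair separately: as \<open>lam < 0\<close>, consecutive
  points of the orbit on the stable axis lie on opposite sides of the saddle, and
  sign changes preserve the normal form of the local map.\<close>

definition global_map ::
  "('a::topological_space \<Rightarrow> 'a) \<Rightarrow> nat \<Rightarrow> 'a \<Rightarrow> 'a set \<Rightarrow> 'a set \<Rightarrow> ('a \<Rightarrow> real^2) \<Rightarrow>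
     'a \<Rightarrow> 'a \<Rightarrow> nat \<Rightarrow> global_coeffs \<Rightarrow> bool" where
  "global_map f per z0 \<Gamma> U0 \<phi> Mp Mm q C \<longleftrightarrow>
     Mp \<in> \<Gamma> \<inter> local_stable_set (f ^^ per) z0 U0 \<and>
     Mm \<in> \<Gamma> \<inter> local_unstable_set (f ^^ per) z0 U0 \<and>
     (f ^^ q) Mm = Mp \<and>
     (\<exists>\<sigma>\<in>{-1, 1}. \<exists>\<tau>\<in>{-1, 1}.
        let \<kappa> = sign_change \<sigma> \<tau> \<circ> \<phi>;
            G = local_expr (U0, \<kappa>) (U0, \<kappa>) (f ^^ q);
            m = vector [0, ym C] :: real^2 in
          \<kappa> Mp = vector [xp C, 0] \<and> \<kappa> Mm = m \<and> xp C > 0 \<and> ym C > 0 \<and>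
          (\<lambda>v. let x = v $ 1; h = v $ 2 - ym C in
             G v $ 1 - xp C - (ca C * x + cb C * h + e20 C * x^2 + e11 C * x * h + e02 C * h^2))
            \<in> o[at m](\<lambda>v. (norm (v - m))^2) \<and>
          (\<lambda>v. let x = v $ 1; h = v $ 2 - ym C in
             G v $ 2 - (cc C * x + cd C * h^2 + f20 C * x^2 + f11 C * x * h))
            \<in> o[at m](\<lambda>v. (norm (v - m))^2)) \<and>
     cd C \<noteq> 0 \<and> \<bar>cb C * cc C\<bar> = 1"

definition needed_type :: "global_coeffs \<Rightarrow> bool" where
  "needed_type C \<longleftrightarrow> cb C * cc C = -1"

definition s0 :: "real \<Rightarrow> global_coeffs \<Rightarrow> real" where
  "s0 \<nu> C = cd C * xp C * (ca C * cc C + f20 C * xp C)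
          + 1/2 * f11 C * xp C * (1 + \<nu> - 1/2 * f11 C * xp C)"

definition homoclinic_setting ::
  "nat \<Rightarrow> 'a::{t2_space, second_countable_topology} chart set \<Rightarrow> ('a chart \<Rightarrow> real^2 \<Rightarrow> real) \<Rightarrow>
     nat \<Rightarrow> 'a \<Rightarrow> real \<Rightarrow> real \<Rightarrow> 'a set \<Rightarrow> ('a \<Rightarrow> 'a) \<Rightarrow> bool" where
  "homoclinic_setting r A \<rho> per z0 lam gam \<Gamma> f \<longleftrightarrow>
     r \<ge> 3 \<and> Ck_atlas r A \<and> area_density r A \<rho> \<and> area_preserving r A \<rho> f \<and>
     saddle_point A f per z0 lam gam \<and> tangent_homoclinic_orbit A f per z0 \<Gamma>"

text \<open>As \<open>gam > 0\<close> below, the sign of the coefficient \<open>cd\<close>, read off in coordinates with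
  \<open>xp > 0\<close> and \<open>ym > 0\<close>, is the same for all pairs of points of the orbit.\<close>

definition H32 ::
  "nat \<Rightarrow> 'a::{t2_space, second_countable_topology} chart set \<Rightarrow> ('a chart \<Rightarrow> real^2 \<Rightarrow> real) \<Rightarrow>
     nat \<Rightarrow> 'a \<Rightarrow> real \<Rightarrow> real \<Rightarrow> 'a set \<Rightarrow> ('a \<Rightarrow> 'a) set" where
  "H32 r A \<rho> per z0 lam gam \<Gamma> =
     {f. homoclinic_setting r A \<rho> per z0 lam gam \<Gamma> f \<and> lam = - inverse gam \<and> lam < 0 \<and>
         (\<exists>U0 \<phi> Mp Mm q C. normal_form_coords A f per z0 lam gam U0 \<phi> \<and>
            global_map f per z0 \<Gamma> U0 \<phi> Mp Mm q C \<and> needed_type C \<and> cd C < 0)}"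

definition H33 ::
  "nat \<Rightarrow> 'a::{t2_space, second_countable_topology} chart set \<Rightarrow> ('a chart \<Rightarrow> real^2 \<Rightarrow> real) \<Rightarrow>
     nat \<Rightarrow> 'a \<Rightarrow> real \<Rightarrow> real \<Rightarrow> 'a set \<Rightarrow> ('a \<Rightarrow> 'a) set" where
  "H33 r A \<rho> per z0 lam gam \<Gamma> =
     {f. homoclinic_setting r A \<rho> per z0 lam gam \<Gamma> f \<and> lam = - inverse gam \<and> lam < 0 \<and>
         (\<exists>U0 \<phi> Mp Mm q C. normal_form_coords A f per z0 lam gam U0 \<phi> \<and>
            global_map f per z0 \<Gamma> U0 \<phi> Mp Mm q C \<and> needed_type C \<and> cd C > 0)}"

end

theory Submission
  imports Defs
begin

text \<open>Two points of the orbit on the local stable manifold, and likewise two points on the local unstable manifold, differ by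
  iterates of the local map \<open>T\<^sub>0\<close>. So the global map of one pair is obtained from that of another by composing it with
  powers of \<open>T\<^sub>0\<close> on either side, and it suffices to see how one such composition changes the coefficients.

  In the second-order normal form \<open>T\<^sub>0\<close> is linear on the axes. Near \<open>M\<^sup>+\<close> it equals its linear part up to a term \<open>O(y\<^sup>2)\<close> in the first
  coordinate and \<open>O(y\<^sup>3)\<close> in the second; near \<open>M\<^sup>-\<close> up to \<open>O(x\<^sup>3)\<close> and \<open>O(x\<^sup>2)\<close>. Since the second component of \<open>T\<^sub>1\<close> vanishes at \<open>M\<^sup>-\<close> and
  has no term linear in \<open>y - y\<^sup>-\<close>, the quadratic terms among these affect only the coefficients \<open>e\<^sub>2\<^sub>0\<close>, \<open>e\<^sub>1\<^sub>1\<close>, \<open>e\<^sub>0\<^sub>2\<close>.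
  The other coefficients behave as if \<open>T\<^sub>0\<close> were linear: each is multiplied by powers of \<open>\<lambda>\<close> and \<open>\<gamma>\<close>
  (\<open>jet_after_local_map\<close>, \<open>jet_before_local_map\<close>). As \<open>(\<lambda> \<gamma>)\<^sup>2 = 1\<close>, the two quantities
  \<open>I = d x\<^sup>+ (a c + f\<^sub>2\<^sub>0 x\<^sup>+)\<close> and \<open>J = b c f\<^sub>1\<^sub>1 x\<^sup>+\<close> do not change, nor do they change when the axes are reflected.
  For pairs of the needed type \<open>b c = - 1\<close>, so \<open>f\<^sub>1\<^sub>1 x\<^sup>+ = - J\<close> and \<open>s\<^sub>0 = I - J (1 + \<nu>\<^sub>1 + J / 2) / 2\<close>.

  To compare two pairs, both are moved to the pair consisting of the later point \<open>M\<^sup>+\<close> and the earlier point \<open>M\<^sup>-\<close>.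
  A homoclinic orbit is not periodic, so there the two global maps are the same power of \<open>f\<^sub>0\<close>, and
  the uniqueness of its second-order expansion (\<open>jet_invariants_unique\<close>) gives the equality of \<open>I\<close> and of \<open>J\<close>.\<close>

section \<open>Second-order expansions of the global map\<close>

text \<open>The second-order expansion of the global map \<open>F\<close> at \<open>M\<close>, in signed coordinates, as a comparison of
functions on the surface itself: remainders are measured along \<open>nhds M\<close>, so that composing global and
local maps only needs their continuity and no inverse of the chart. \<open>s\<close> and \<open>t\<close> are the coefficients
\<open>f\<^sub>2\<^sub>0\<close> and \<open>f\<^sub>1\<^sub>1\<close>. The first component is recorded to first order only: the local map sends its quadratic terms
to quadratic terms of the first component, and these never reach the second component.\<close>

definition transition_jet ::
  "('a::topological_space \<Rightarrow> real^2) \<Rightarrow> ('a \<Rightarrow> 'a) \<Rightarrow> 'a \<Rightarrow> 'a \<Rightarrow>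
     real \<Rightarrow> real \<Rightarrow> real \<Rightarrow> real \<Rightarrow> real \<Rightarrow> real \<Rightarrow> bool" where
  "transition_jet \<phi> F M N a b c d s t \<longleftrightarrow>
     F M = N \<and> \<phi> M $ 1 = 0 \<and> \<phi> N $ 2 = 0 \<and>
     (\<lambda>p. \<phi> (F p) $ 1 - \<phi> N $ 1 - (a * \<phi> p $ 1 + b * (\<phi> p $ 2 - \<phi> M $ 2)))
       \<in> O[nhds M](\<lambda>p. (norm (\<phi> p - \<phi> M))^2) \<and>
     (\<lambda>p. \<phi> (F p) $ 2 - (c * \<phi> p $ 1 + d * (\<phi> p $ 2 - \<phi> M $ 2)^2 + s * (\<phi> p $ 1)^2
            + t * \<phi> p $ 1 * (\<phi> p $ 2 - \<phi> M $ 2)))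
       \<in> o[nhds M](\<lambda>p. (norm (\<phi> p - \<phi> M))^2)"

text \<open>What the normal form says about second-order expansions: it is linear up to terms that vanish to second order
on one axis and to third order on the other.\<close>

definition axis_estimates where
  "axis_estimates \<phi> g lam gam N \<longleftrightarrow>
     (\<lambda>p. \<phi> (g p) $ 1 - lam * \<phi> p $ 1) \<in> O[nhds N](\<lambda>p. (\<phi> p $ 1)^3 * (\<phi> p $ 2)^2) \<and>
     (\<lambda>p. \<phi> (g p) $ 2 - gam * \<phi> p $ 2) \<in> O[nhds N](\<lambda>p. (\<phi> p $ 1)^2 * (\<phi> p $ 2)^3)"
 for \<phi> :: "'a::topological_space \<Rightarrow> real^2"

lemma bigo_const_of_tendsto:
  fixes u :: "'a \<Rightarrow> real"
  assumes "(u \<longlongrightarrow> l) F" shows "u \<in> O[F](\<lambda>_. 1)"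
proof (rule bigoI[where c = "\<bar>l\<bar> + 1"])
  have "eventually (\<lambda>x. dist (u x) l < 1) F" using assms by (rule tendstoD) simp
  then show "eventually (\<lambda>x. norm (u x) \<le> (\<bar>l\<bar> + 1) * norm (1::real)) F"
    by eventually_elim (auto simp: dist_real_def)
qed

text \<open>\<open>nhds x\<close> contains \<open>x\<close> itself, so an estimate along it also yields exact values, for instance the linearity
of the local map on the axes.\<close>

lemma bigo_at_point:
  fixes u :: "'a::topological_space \<Rightarrow> real"
  assumes "u \<in> O[nhds x](v)" "v x = 0" shows "u x = 0"
proof -
  obtain c where "eventually (\<lambda>y. norm (u y) \<le> c * norm (v y)) (nhds x)"
    using assms(1) by (rule landau_o.bigE)
  from eventually_nhds_x_imp_x[OF this] assms(2) show ?thesis by simp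
qed

lemma deviation_orders:
  fixes \<phi> :: "'a::topological_space \<Rightarrow> real^2"
  assumes "(\<phi> \<longlongrightarrow> \<phi> M) (nhds M)" "\<phi> M $ 1 = 0"
  defines "\<rho> \<equiv> \<lambda>p. norm (\<phi> p - \<phi> M)"
  shows "(\<lambda>p. \<phi> p $ 1) \<in> O[nhds M](\<rho>)" "(\<lambda>p. \<phi> p $ 2 - \<phi> M $ 2) \<in> O[nhds M](\<rho>)"
    and "(\<lambda>p. \<rho> p ^ 2) \<in> O[nhds M](\<rho>)"
    and "(\<lambda>p. \<rho> p ^ 3) \<in> o[nhds M](\<lambda>p. \<rho> p ^ 2)"
proof -
  have lim: "(\<rho> \<longlongrightarrow> 0) (nhds M)"
    unfolding \<rho>_def using tendsto_norm[OF tendsto_diff[OF assms(1) tendsto_const[of "\<phi> M"]]] by simp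
  have c: "\<bar>\<phi> p $ i - \<phi> M $ i\<bar> \<le> \<rho> p" for p i
    unfolding \<rho>_def using component_le_norm_cart[of "\<phi> p - \<phi> M" i] by simp
  have nn: "0 \<le> \<rho> p" for p by (simp add: \<rho>_def)
  show "(\<lambda>p. \<phi> p $ 1) \<in> O[nhds M](\<rho>)"
    by (rule landau_o.bigI[where c=1]) (use c[of _ 1] assms(2) nn in auto)
  show "(\<lambda>p. \<phi> p $ 2 - \<phi> M $ 2) \<in> O[nhds M](\<rho>)"
    by (rule landau_o.bigI[where c=1]) (use c[of _ 2] nn in auto)
  have b: "\<rho> \<in> O[nhds M](\<lambda>_. 1)" by (rule bigo_const_of_tendsto[OF lim])
  have small: "\<rho> \<in> o[nhds M](\<lambda>_. 1)" using lim by (intro smalloI_tendsto) auto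
  show "(\<lambda>p. \<rho> p ^ 2) \<in> O[nhds M](\<rho>)"
    using landau_o.big.mult[OF b landau_o.big_refl[of \<rho>]] by (simp add: power2_eq_square)
  show "(\<lambda>p. \<rho> p ^ 3) \<in> o[nhds M](\<lambda>p. \<rho> p ^ 2)"
    using landau_o.small_big_mult[OF small landau_o.big_refl[of "\<lambda>p. \<rho> p ^ 2"]]
    by (simp add: power3_eq_cube power2_eq_square mult.assoc)
qed

lemma quadratic_terms_bigo:
  fixes \<phi> :: "'a::topological_space \<Rightarrow> real^2"
  assumes "(\<phi> \<longlongrightarrow> \<phi> M) (nhds M)" "\<phi> M $ 1 = 0"
  shows "(\<lambda>p. u * (\<phi> p $ 1)^2 + v * (\<phi> p $ 1 * (\<phi> p $ 2 - \<phi> M $ 2)) + w * (\<phi> p $ 2 - \<phi> M $ 2)^2)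
      \<in> O[nhds M](\<lambda>p. (norm (\<phi> p - \<phi> M))^2)"
proof -
  note X = deviation_orders(1)[OF assms] and h = deviation_orders(2)[OF assms]
  show ?thesis
    using landau_o.big_power[OF X, of 2] landau_o.big_power[OF h, of 2] landau_o.big.mult[OF X h]
    by (intro sum_in_bigo) (auto simp: power2_eq_square)
qed

text \<open>The remainder of the local map near the horizontal axis is \<open>O(y\<^sup>2)\<close> in the first coordinate and \<open>O(y\<^sup>3)\<close> in
the second. As the second component of \<open>F\<close> is \<open>O(\<rho>)\<close>, these become \<open>O(\<rho>\<^sup>2)\<close> and \<open>O(\<rho>\<^sup>3)\<close>, which is within the
recorded precision.\<close>

lemma jet_after_local_map:
  fixes \<phi> :: "'a::topological_space \<Rightarrow> real^2"
  assumes jet: "transition_jet \<phi> F M N a b c d s t" and loc: "axis_estimates \<phi> g lam gam N"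
    and F: "(F \<longlongrightarrow> N) (nhds M)"
    and \<phi>M: "(\<phi> \<longlongrightarrow> \<phi> M) (nhds M)" and \<phi>N: "(\<phi> \<longlongrightarrow> \<phi> N) (nhds N)"
  shows "transition_jet \<phi> (g \<circ> F) M (g N) (lam * a) (lam * b) (gam * c) (gam * d) (gam * s) (gam * t)"
    and "\<phi> (g N) $ 1 = lam * \<phi> N $ 1"
proof -
  define \<rho> where "\<rho> = (\<lambda>p. norm (\<phi> p - \<phi> M))"
  define X where "X = (\<lambda>p. \<phi> p $ 1)"
  define Y where "Y = (\<lambda>p. \<phi> p $ 2)"
  define h where "h = (\<lambda>p. Y p - Y M)"
  define r1 where "r1 = (\<lambda>p. X (F p) - X N - (a * X p + b * h p))"
  define r2 where "r2 = (\<lambda>p. Y (F p) - (c * X p + d * h p ^ 2 + s * X p ^ 2 + t * X p * h p))"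
  define e1 where "e1 = (\<lambda>p. X (g p) - lam * X p)"
  define e2 where "e2 = (\<lambda>p. Y (g p) - gam * Y p)"
  have FM: "F M = N" and XM: "X M = 0" and YN: "Y N = 0"
    and r1: "r1 \<in> O[nhds M](\<lambda>p. \<rho> p ^ 2)" and r2: "r2 \<in> o[nhds M](\<lambda>p. \<rho> p ^ 2)"
    using jet by (auto simp: transition_jet_def X_def Y_def h_def r1_def r2_def \<rho>_def)
  note dev = deviation_orders[OF \<phi>M XM[unfolded X_def]]
  have square: "(\<lambda>p. \<rho> p ^ 2) \<in> O[nhds M](\<rho>)"
    and cube: "(\<lambda>p. \<rho> p ^ 3) \<in> o[nhds M](\<lambda>p. \<rho> p ^ 2)"
    using dev(3,4) by (simp_all add: \<rho>_def)
  have X: "X \<in> O[nhds M](\<rho>)" and h: "h \<in> O[nhds M](\<rho>)"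
    using dev(1,2) by (simp_all add: X_def h_def Y_def \<rho>_def)
  have e1: "e1 \<in> O[nhds N](\<lambda>p. X p ^ 3 * Y p ^ 2)" and e2: "e2 \<in> O[nhds N](\<lambda>p. X p ^ 2 * Y p ^ 3)"
    using loc by (auto simp: axis_estimates_def X_def Y_def e1_def e2_def)
  have "(X \<longlongrightarrow> X N) (nhds N)" unfolding X_def by (rule tendsto_vec_nth[OF \<phi>N])
  then have XB: "X \<in> O[nhds N](\<lambda>_. 1)" by (rule bigo_const_of_tendsto)
  have e1': "e1 \<in> O[nhds N](\<lambda>p. Y p ^ 2)"
    using landau_o.big_trans[OF e1 landau_o.big.mult[OF landau_o.big_power[OF XB, of 3] landau_o.big_refl]]
    by simp
  have e2': "e2 \<in> O[nhds N](\<lambda>p. Y p ^ 3)"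
    using landau_o.big_trans[OF e2 landau_o.big.mult[OF landau_o.big_power[OF XB, of 2] landau_o.big_refl]]
    by simp
  have quad: "(\<lambda>p. d * h p ^ 2 + s * X p ^ 2 + t * (X p * h p)) \<in> O[nhds M](\<lambda>p. \<rho> p ^ 2)"
    using quadratic_terms_bigo[OF \<phi>M XM[unfolded X_def], of s t d]
    by (simp add: X_def Y_def h_def \<rho>_def add_ac)
  have "(\<lambda>p. c * X p) \<in> O[nhds M](\<rho>)" using X by simp
  from sum_in_bigo(1)[OF sum_in_bigo(1)[OF this landau_o.big_trans[OF quad square]]
      landau_o.big_trans[OF landau_o.small_imp_big[OF r2] square]]
  have YF: "(\<lambda>p. Y (F p)) \<in> O[nhds M](\<rho>)" by (simp add: r2_def algebra_simps)
  have e1F: "(\<lambda>p. e1 (F p)) \<in> O[nhds M](\<lambda>p. \<rho> p ^ 2)"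
    by (rule landau_o.big_trans[OF landau_o.big.compose[OF e1' F] landau_o.big_power[OF YF]])
  have e2F: "(\<lambda>p. e2 (F p)) \<in> o[nhds M](\<lambda>p. \<rho> p ^ 2)"
    by (rule landau_o.big_small_trans
        [OF landau_o.big_trans[OF landau_o.big.compose[OF e2' F] landau_o.big_power[OF YF]] cube])
  have XgN: "X (g N) = lam * X N" and YgN: "Y (g N) = 0"
    using bigo_at_point[OF e1'] bigo_at_point[OF e2'] YN by (auto simp: e1_def e2_def)
  show "\<phi> (g N) $ 1 = lam * \<phi> N $ 1" using XgN by (simp add: X_def)
  have "(\<lambda>p. lam * r1 p + e1 (F p)) \<in> O[nhds M](\<lambda>p. \<rho> p ^ 2)"
    using r1 e1F by (intro sum_in_bigo) auto
  moreover have "(\<lambda>p. gam * r2 p + e2 (F p)) \<in> o[nhds M](\<lambda>p. \<rho> p ^ 2)"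
    using r2 e2F by (intro sum_in_smallo) auto
  ultimately show "transition_jet \<phi> (g \<circ> F) M (g N) (lam * a) (lam * b) (gam * c) (gam * d) (gam * s) (gam * t)"
    using XM XgN YgN FM
    by (simp add: transition_jet_def r1_def r2_def e1_def e2_def h_def X_def Y_def \<rho>_def algebra_simps)
qed

text \<open>Near the vertical axis the remainder of the local map is \<open>O(x\<^sup>3)\<close> in the first coordinate but only \<open>O(x\<^sup>2)\<close>
in the second. The latter, a genuine quadratic term, is harmless because the second component of \<open>F\<close> has no term
linear in \<open>y - y\<^sup>-\<close>: this is where the tangency enters. In that component it only occurs in products
of at least third order.\<close>

lemma jet_before_local_map:
  fixes \<phi> :: "'a::topological_space \<Rightarrow> real^2"
  assumes jet: "transition_jet \<phi> F (g P) N a b c d s t" and loc: "axis_estimates \<phi> g lam gam P"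
    and g: "(g \<longlongrightarrow> g P) (nhds P)" and axis: "\<phi> P $ 1 = 0"
    and \<phi>P: "(\<phi> \<longlongrightarrow> \<phi> P) (nhds P)"
  shows "transition_jet \<phi> (F \<circ> g) P N
           (lam * a) (gam * b) (lam * c) (gam^2 * d) (lam^2 * s) (lam * gam * t)"
proof -
  define M where "M = g P"
  define \<rho>M where "\<rho>M = (\<lambda>p. norm (\<phi> p - \<phi> M))"
  define \<rho> where "\<rho> = (\<lambda>p. norm (\<phi> p - \<phi> P))"
  define X where "X = (\<lambda>p. \<phi> p $ 1)"
  define Y where "Y = (\<lambda>p. \<phi> p $ 2)"
  define h where "h = (\<lambda>p. Y p - Y P)"
  define k where "k = (\<lambda>p. Y p - Y M)"
  define r1 where "r1 = (\<lambda>p. X (F p) - X N - (a * X p + b * k p))"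
  define r2 where "r2 = (\<lambda>p. Y (F p) - (c * X p + d * k p ^ 2 + s * X p ^ 2 + t * X p * k p))"
  define e1 where "e1 = (\<lambda>p. X (g p) - lam * X p)"
  define e2 where "e2 = (\<lambda>p. Y (g p) - gam * Y p)"
  have FM: "F M = N" and XM: "X M = 0" and YN: "Y N = 0"
    and r1: "r1 \<in> O[nhds M](\<lambda>p. \<rho>M p ^ 2)" and r2: "r2 \<in> o[nhds M](\<lambda>p. \<rho>M p ^ 2)"
    using jet by (auto simp: transition_jet_def X_def Y_def k_def r1_def r2_def \<rho>M_def M_def)
  have XP: "X P = 0" using axis by (simp add: X_def)
  note dev = deviation_orders[OF \<phi>P axis]
  have square: "(\<lambda>p. \<rho> p ^ 2) \<in> O[nhds P](\<rho>)"
    and cube: "(\<lambda>p. \<rho> p ^ 3) \<in> o[nhds P](\<lambda>p. \<rho> p ^ 2)"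
    using dev(3,4) by (simp_all add: \<rho>_def)
  have X: "X \<in> O[nhds P](\<rho>)" and h: "h \<in> O[nhds P](\<rho>)"
    using dev(1,2) by (simp_all add: X_def h_def Y_def \<rho>_def)
  have e1: "e1 \<in> O[nhds P](\<lambda>p. X p ^ 3 * Y p ^ 2)" and e2: "e2 \<in> O[nhds P](\<lambda>p. X p ^ 2 * Y p ^ 3)"
    using loc by (auto simp: axis_estimates_def X_def Y_def e1_def e2_def)
  have "(Y \<longlongrightarrow> Y P) (nhds P)" unfolding Y_def by (rule tendsto_vec_nth[OF \<phi>P])
  then have YB: "Y \<in> O[nhds P](\<lambda>_. 1)" by (rule bigo_const_of_tendsto)
  have e1': "e1 \<in> O[nhds P](\<lambda>p. \<rho> p ^ 3)"
    using landau_o.big_trans[OF e1 landau_o.big.mult[OF landau_o.big_power[OF X, of 3] landau_o.big_power[OF YB, of 2]]]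
    by simp
  have e2': "e2 \<in> O[nhds P](\<lambda>p. \<rho> p ^ 2)"
    using landau_o.big_trans[OF e2 landau_o.big.mult[OF landau_o.big_power[OF X, of 2] landau_o.big_power[OF YB, of 3]]]
    by simp
  have YgP: "Y M = gam * Y P"
    using bigo_at_point[OF e2'] by (auto simp: e2_def M_def \<rho>_def)
  have kg: "k (g p) = gam * h p + e2 p" for p by (simp add: k_def e2_def h_def YgP algebra_simps)
  have Xg: "X (g p) = lam * X p + e1 p" for p by (simp add: e1_def)
  have s3: "e1 \<in> o[nhds P](\<lambda>p. \<rho> p ^ 2)" by (rule landau_o.big_small_trans[OF e1' cube])
  have e1'': "e1 \<in> O[nhds P](\<lambda>p. \<rho> p ^ 2)" by (rule landau_o.small_imp_big[OF s3])
  have e1r: "e1 \<in> O[nhds P](\<rho>)" by (rule landau_o.big_trans[OF e1'' square])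
  have e2r: "e2 \<in> O[nhds P](\<rho>)" by (rule landau_o.big_trans[OF e2' square])
  have kgr: "(\<lambda>p. k (g p)) \<in> O[nhds P](\<rho>)" unfolding kg using h e2r by (intro sum_in_bigo) auto
  have Xgr: "(\<lambda>p. X (g p)) \<in> O[nhds P](\<rho>)" unfolding Xg using X e1r by (intro sum_in_bigo) auto
  have "(\<lambda>p. \<rho>M (g p)) \<in> O[nhds P](\<lambda>p. \<bar>X (g p)\<bar> + \<bar>k (g p)\<bar>)"
  proof (rule landau_o.bigI[where c=1], simp, rule always_eventually, rule allI)
    fix p
    show "norm (\<rho>M (g p)) \<le> 1 * norm (\<bar>X (g p)\<bar> + \<bar>k (g p)\<bar>)"
      using norm_le_l1_cart[of "\<phi> (g p) - \<phi> M"] XM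
      by (simp add: \<rho>M_def X_def k_def Y_def UNIV_2)
  qed
  also have "(\<lambda>p. \<bar>X (g p)\<bar> + \<bar>k (g p)\<bar>) \<in> O[nhds P](\<rho>)"
    using Xgr kgr by (intro sum_in_bigo) auto
  finally have \<rho>g: "(\<lambda>p. \<rho>M (g p) ^ 2) \<in> O[nhds P](\<lambda>p. \<rho> p ^ 2)"
    by (rule landau_o.big_power)
  have g': "(g \<longlongrightarrow> M) (nhds P)" using g by (simp add: M_def)
  have r1g: "(\<lambda>p. r1 (g p)) \<in> O[nhds P](\<lambda>p. \<rho> p ^ 2)"
    by (rule landau_o.big_trans[OF landau_o.big.compose[OF r1 g'] \<rho>g])
  have r2g: "(\<lambda>p. r2 (g p)) \<in> o[nhds P](\<lambda>p. \<rho> p ^ 2)"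
    by (rule landau_o.small_big_trans[OF landau_o.small.compose[OF r2 g'] \<rho>g])
  \<comment> \<open>each error that the local map adds to the quadratic part has a further factor \<open>O(\<rho>)\<close>\<close>
  have cubic: "(\<lambda>p. u p * v p) \<in> o[nhds P](\<lambda>p. \<rho> p ^ 2)"
    if "u \<in> O[nhds P](\<rho>)" "v \<in> O[nhds P](\<lambda>p. \<rho> p ^ 2)" for u v
    using landau_o.big_small_trans[OF _ cube] landau_o.big.mult[OF that]
    by (simp add: power3_eq_cube power2_eq_square mult.assoc)
  have "(\<lambda>p. r1 (g p) + a * e1 p + b * e2 p) \<in> O[nhds P](\<lambda>p. \<rho> p ^ 2)"
    using r1g e1'' e2' by (intro sum_in_bigo) auto
  moreover have "(\<lambda>p. r1 (g p) + a * e1 p + b * e2 p) = (\<lambda>p. X (F (g p)) - X N - (lam * a * X p + gam * b * h p))"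
    unfolding r1_def kg Xg by (auto simp: algebra_simps)
  moreover have "(\<lambda>p. r2 (g p) + c * e1 p
        + d * (2 * gam * (h p * e2 p) + e2 p * e2 p)
        + s * (2 * lam * (X p * e1 p) + e1 p * e1 p)
        + t * (lam * (X p * e2 p) + k (g p) * e1 p)) \<in> o[nhds P](\<lambda>p. \<rho> p ^ 2)"
    using r2g s3 cubic[OF h e2'] cubic[OF e2r e2'] cubic[OF X e1''] cubic[OF e1r e1'']
      cubic[OF X e2'] cubic[OF kgr e1'']
    by (intro sum_in_smallo) (auto simp del: mult.assoc intro!: sum_in_smallo)
  moreover have "(\<lambda>p. r2 (g p) + c * e1 p
        + d * (2 * gam * (h p * e2 p) + e2 p * e2 p)
        + s * (2 * lam * (X p * e1 p) + e1 p * e1 p)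
        + t * (lam * (X p * e2 p) + k (g p) * e1 p)) =
     (\<lambda>p. Y (F (g p)) - (lam * c * X p + gam^2 * d * h p ^ 2 + lam^2 * s * X p ^ 2 + lam * gam * t * X p * h p))"
    unfolding r2_def kg Xg by (auto simp: algebra_simps power2_eq_square)
  ultimately show ?thesis
    using FM XP YN
    by (simp add: transition_jet_def h_def X_def Y_def \<rho>_def M_def)
qed

section \<open>Uniqueness of the expansion\<close>

text \<open>Dividing by \<open>t\<^sup>2\<close> and multiplying the limit by \<open>t\<close> isolates \<open>\<alpha>\<close>; once it vanishes the quotient is the constant \<open>\<beta>\<close>.\<close>

lemma quadratic_smallo_zero:
  fixes \<alpha> \<beta> :: real
  assumes "(\<lambda>t. \<alpha> * t + \<beta> * t^2) \<in> o[nhds 0](\<lambda>t. t^2)"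
  shows "\<alpha> = 0" "\<beta> = 0"
proof -
  have "(\<lambda>t. \<alpha> * t + \<beta> * t^2) \<in> o[at 0](\<lambda>t. t^2)"
    by (rule landau_o.small.filter_mono[OF _ assms]) (simp add: at_within_def)
  then have lim: "((\<lambda>t. (\<alpha> * t + \<beta> * t^2) / t^2) \<longlongrightarrow> 0) (at 0)"
    by (rule smalloD_tendsto)
  have "((\<lambda>t. \<alpha> + \<beta> * t) \<longlongrightarrow> \<alpha> + \<beta> * 0) (at 0)" by (intro tendsto_intros)
  moreover have "((\<lambda>t. \<alpha> + \<beta> * t) \<longlongrightarrow> 0 * 0) (at 0)"
    by (rule Lim_transform_eventually[OF tendsto_mult[OF lim tendsto_ident_at]])
      (auto simp: eventually_at_filter power2_eq_square divide_simps algebra_simps)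
  ultimately show \<alpha>: "\<alpha> = 0" using tendsto_unique[of "at (0::real)"] by fastforce
  have "((\<lambda>t::real. \<beta>) \<longlongrightarrow> 0) (at 0)"
    by (rule Lim_transform_eventually[OF lim]) (auto simp: eventually_at_filter \<alpha>)
  then show "\<beta> = 0" by (simp add: tendsto_const_iff)
qed

lemma linear_bigo_zero:
  fixes \<alpha> :: real
  assumes "(\<lambda>t. \<alpha> * t) \<in> O[nhds 0](\<lambda>t. t^2)"
  shows "\<alpha> = 0"
proof -
  have "((\<lambda>t::real. t) \<longlongrightarrow> 0) (nhds 0)" by (simp add: filterlim_def)
  then have "(\<lambda>t::real. t) \<in> o[nhds 0](\<lambda>_. 1)" by (intro smalloI_tendsto) auto
  from landau_o.small_big_mult[OF this assms]
  have "(\<lambda>t. 0 * t + \<alpha> * t^2) \<in> o[nhds 0](\<lambda>t. t^2)" by (simp add: power2_eq_square mult_ac)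
  then show ?thesis by (rule quadratic_smallo_zero)
qed

text \<open>Coefficients of expansions on the surface are compared along preimages of straight lines, which exist because the
chart is open.\<close>

lemma chart_line:
  assumes chart: "is_chart (U, \<phi>)" and M: "M \<in> U"
  obtains curve where "(curve \<longlongrightarrow> M) (nhds (0::real))" "eventually (\<lambda>t. \<phi> (curve t) = \<phi> M + t *\<^sub>R e) (nhds 0)"
proof -
  obtain \<psi> where op: "open (\<phi> ` U)" and \<psi>: "homeomorphism U (\<phi> ` U) \<phi> \<psi>"
    using chart by (auto simp: is_chart_def)
  have lim: "((\<lambda>t. \<phi> M + t *\<^sub>R e) \<longlongrightarrow> \<phi> M + 0 *\<^sub>R e) (nhds 0)"
    by (intro tendsto_intros) (simp add: filterlim_def)
  then have ev: "eventually (\<lambda>t. \<phi> M + t *\<^sub>R e \<in> \<phi> ` U) (nhds 0)"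
    using op M by (auto dest!: topological_tendstoD)
  have "isCont \<psi> (\<phi> M)"
    using \<psi> op M by (auto simp: homeomorphism_def continuous_on_eq_continuous_at)
  then have "(\<psi> \<longlongrightarrow> \<psi> (\<phi> M)) (nhds (\<phi> M))"
    by (simp add: isCont_def tendsto_at_iff_tendsto_nhds)
  from filterlim_compose[OF this] lim
  have "((\<lambda>t. \<psi> (\<phi> M + t *\<^sub>R e)) \<longlongrightarrow> M) (nhds 0)"
    using \<psi> M by (auto simp: homeomorphism_def)
  moreover have "eventually (\<lambda>t. \<phi> (\<psi> (\<phi> M + t *\<^sub>R e)) = \<phi> M + t *\<^sub>R e) (nhds 0)"
    using ev by eventually_elim (use \<psi> in \<open>auto simp: homeomorphism_def\<close>)
  ultimately show thesis by (rule that)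
qed

text \<open>The difference of two expansions is a polynomial that is smaller than the precision. Restricting it to the lines in the
directions \<open>(1, 0)\<close>, \<open>(0, 1)\<close> and \<open>(1, 1)\<close> separates all the coefficients.\<close>

lemma transition_jet_unique:
  assumes chart: "is_chart (U, \<phi>)" and M: "M \<in> U"
    and jet: "transition_jet \<phi> F M N a b c d s t" and jet': "transition_jet \<phi> F M N a' b' c' d' s' t'"
  shows "a = a'" "b = b'" "c = c'" "d = d'" "s = s'" "t = t'"
proof -
  define X where "X = (\<lambda>p. \<phi> p $ 1)"
  define h where "h = (\<lambda>p. \<phi> p $ 2 - \<phi> M $ 2)"
  have XM: "\<phi> M $ 1 = 0" using jet by (simp add: transition_jet_def)
  define R1 where "R1 = (\<lambda>a b p. \<phi> (F p) $ 1 - \<phi> N $ 1 - (a * X p + b * h p))"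
  define R2 where "R2 = (\<lambda>c d s t p. \<phi> (F p) $ 2 - (c * X p + d * h p ^ 2 + s * X p ^ 2 + t * X p * h p))"
  have jet1: "R1 a' b' \<in> O[nhds M](\<lambda>p. (norm (\<phi> p - \<phi> M))^2)" "R1 a b \<in> O[nhds M](\<lambda>p. (norm (\<phi> p - \<phi> M))^2)"
    and jet2: "R2 c' d' s' t' \<in> o[nhds M](\<lambda>p. (norm (\<phi> p - \<phi> M))^2)" "R2 c d s t \<in> o[nhds M](\<lambda>p. (norm (\<phi> p - \<phi> M))^2)"
    using jet jet' by (simp_all add: transition_jet_def R1_def R2_def X_def h_def)
  have first: "(\<lambda>p. (a - a') * X p + (b - b') * h p) \<in> O[nhds M](\<lambda>p. (norm (\<phi> p - \<phi> M))^2)"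
    using sum_in_bigo(2)[OF jet1(1) jet1(2)] by (simp add: R1_def algebra_simps)
  have second: "(\<lambda>p. (c - c') * X p + (d - d') * h p ^ 2 + (s - s') * X p ^ 2 + (t - t') * X p * h p)
      \<in> o[nhds M](\<lambda>p. (norm (\<phi> p - \<phi> M))^2)"
    using sum_in_smallo(2)[OF jet2(1) jet2(2)] by (simp add: R2_def algebra_simps)
  have along: "(a - a') * u + (b - b') * v = 0 \<and> (c - c') * u = 0 \<and>
      (d - d') * v^2 + (s - s') * u^2 + (t - t') * u * v = 0" if "u^2 + v^2 \<noteq> 0" for u v :: real
  proof -
    define e where "e = (vector [u, v] :: real^2)"
    have ne: "norm e \<noteq> 0" using that by (auto simp: e_def norm_eq_sqrt_inner inner_vec_def UNIV_2 power2_eq_square)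
    obtain curve where curve: "(curve \<longlongrightarrow> M) (nhds (0::real))"
      and ev: "eventually (\<lambda>t. \<phi> (curve t) = \<phi> M + t *\<^sub>R e) (nhds 0)"
      by (rule chart_line[OF chart M, of e]) blast
    have norm_ev: "eventually (\<lambda>\<tau>. (norm (\<phi> (curve \<tau>) - \<phi> M))^2 = (norm e)^2 * \<tau>^2) (nhds 0)"
      using ev by eventually_elim (simp add: power_mult_distrib)
    have "(\<lambda>\<tau>. (a - a') * X (curve \<tau>) + (b - b') * h (curve \<tau>)) \<in> O[nhds 0](\<lambda>\<tau>. (norm e)^2 * \<tau>^2)"
      using landau_o.big.compose[OF first curve] by (subst (asm) landau_o.big.cong[OF norm_ev])
    moreover have "eventually (\<lambda>\<tau>. (a - a') * X (curve \<tau>) + (b - b') * h (curve \<tau>)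
        = ((a - a') * u + (b - b') * v) * \<tau>) (nhds 0)"
      using ev by eventually_elim (simp add: X_def h_def e_def XM algebra_simps)
    ultimately have "(\<lambda>\<tau>. ((a - a') * u + (b - b') * v) * \<tau>) \<in> O[nhds 0](\<lambda>\<tau>. (norm e)^2 * \<tau>^2)"
      by (rule iffD1[OF landau_o.big.in_cong, rotated])
    then have 1: "(a - a') * u + (b - b') * v = 0" using ne by (intro linear_bigo_zero) auto
    have "(\<lambda>\<tau>. (c - c') * X (curve \<tau>) + (d - d') * h (curve \<tau>) ^ 2 + (s - s') * X (curve \<tau>) ^ 2
        + (t - t') * X (curve \<tau>) * h (curve \<tau>)) \<in> o[nhds 0](\<lambda>\<tau>. (norm e)^2 * \<tau>^2)"
      using landau_o.small.compose[OF second curve] by (subst (asm) landau_o.small.cong[OF norm_ev])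
    moreover have "eventually (\<lambda>\<tau>. (c - c') * X (curve \<tau>) + (d - d') * h (curve \<tau>) ^ 2 + (s - s') * X (curve \<tau>) ^ 2
        + (t - t') * X (curve \<tau>) * h (curve \<tau>)
        = ((c - c') * u) * \<tau> + ((d - d') * v^2 + (s - s') * u^2 + (t - t') * u * v) * \<tau>^2) (nhds 0)"
      using ev by eventually_elim (simp add: X_def h_def e_def XM algebra_simps power2_eq_square)
    ultimately have "(\<lambda>\<tau>. ((c - c') * u) * \<tau> + ((d - d') * v^2 + (s - s') * u^2 + (t - t') * u * v) * \<tau>^2)
        \<in> o[nhds 0](\<lambda>\<tau>. (norm e)^2 * \<tau>^2)"
      by (rule iffD1[OF landau_o.small.in_cong, rotated])
    then have "(\<lambda>\<tau>. ((c - c') * u) * \<tau> + ((d - d') * v^2 + (s - s') * u^2 + (t - t') * u * v) * \<tau>^2)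
        \<in> o[nhds 0](\<lambda>\<tau>. \<tau>^2)" using ne by auto
    from quadratic_smallo_zero[OF this] 1 show ?thesis by simp
  qed
  show "a = a'" "b = b'" "c = c'" "d = d'" "s = s'" "t = t'"
    using along[of 1 0] along[of 0 1] along[of 1 1] by auto
qed

section \<open>Quantities invariant under the local map\<close>

text \<open>\<open>I\<close> is \<open>d x\<^sup>+ (a c + f\<^sub>2\<^sub>0 x\<^sup>+)\<close> and \<open>J\<close> is \<open>b c f\<^sub>1\<^sub>1 x\<^sup>+\<close>. The factor \<open>b c\<close> of \<open>J\<close> cancels the sign
\<open>\<lambda> \<gamma> = - 1\<close> that \<open>f\<^sub>1\<^sub>1 x\<^sup>+\<close> acquires with each application of the local map.\<close>

definition jet_with_invariants ::
  "('a::topological_space \<Rightarrow> real^2) \<Rightarrow> ('a \<Rightarrow> 'a) \<Rightarrow> 'a \<Rightarrow> 'a \<Rightarrow> real \<Rightarrow> real \<Rightarrow> bool" where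
  "jet_with_invariants \<phi> F M N I J \<longleftrightarrow>
     (\<exists>a b c d s t. transition_jet \<phi> F M N a b c d s t \<and>
        I = d * \<phi> N $ 1 * (a * c + s * \<phi> N $ 1) \<and> J = b * c * t * \<phi> N $ 1)"

lemma jet_invariants_unique:
  assumes "is_chart (U, \<phi>)" "M \<in> U"
    and "jet_with_invariants \<phi> F M N I J" "jet_with_invariants \<phi> F M N I' J'"
  shows "I = I' \<and> J = J'"
proof -
  obtain a b c d s t where jet: "transition_jet \<phi> F M N a b c d s t"
    and IJ: "I = d * \<phi> N $ 1 * (a * c + s * \<phi> N $ 1)" "J = b * c * t * \<phi> N $ 1"
    using assms(3) unfolding jet_with_invariants_def by blast
  obtain a' b' c' d' s' t' where jet': "transition_jet \<phi> F M N a' b' c' d' s' t'"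
    and IJ': "I' = d' * \<phi> N $ 1 * (a' * c' + s' * \<phi> N $ 1)" "J' = b' * c' * t' * \<phi> N $ 1"
    using assms(4) unfolding jet_with_invariants_def by blast
  show ?thesis
    using transition_jet_unique[OF assms(1,2) jet jet'] unfolding IJ IJ' by simp
qed

lemma chart_tendsto:
  fixes \<phi> :: "'a::t2_space \<Rightarrow> real^2"
  assumes "is_chart (U, \<phi>)" "p \<in> U" shows "(\<phi> \<longlongrightarrow> \<phi> p) (nhds p)"
proof -
  have "open U" "continuous_on U \<phi>" using assms(1) by (auto simp: is_chart_def homeomorphism_def)
  then show ?thesis
    using assms(2) by (auto simp: continuous_on_eq_continuous_at isCont_def tendsto_at_iff_tendsto_nhds)
qed

lemma continuous_tendsto_nhds:
  fixes f :: "'a::t2_space \<Rightarrow> 'b::topological_space"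
  assumes "continuous_on UNIV f" shows "(f \<longlongrightarrow> f p) (nhds p)"
  using assms by (auto simp: continuous_on_eq_continuous_at isCont_def tendsto_at_iff_tendsto_nhds)

lemma continuous_funpow:
  fixes f :: "'a::topological_space \<Rightarrow> 'a"
  assumes "continuous_on UNIV f" shows "continuous_on UNIV (f ^^ n)"
proof (induction n)
  case (Suc n)
  show ?case
    unfolding funpow.simps
    by (rule continuous_on_compose[OF Suc.IH continuous_on_subset[OF assms subset_UNIV]])
qed (simp add: id_def)

text \<open>The part of the normal form that acts on second-order expansions: \<open>g\<close> is the map whose restriction to \<open>U\<close> is the local
map, and its estimates hold at every point that it does not move out of \<open>U\<close>.\<close>

locale local_saddle_map =
  fixes U :: "'a::t2_space set" and \<phi> :: "'a \<Rightarrow> real^2" and g :: "'a \<Rightarrow> 'a" and lam gam :: real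
  assumes chart: "is_chart (U, \<phi>)"
    and cont: "continuous_on UNIV g"
    and estimates: "\<And>p. p \<in> U \<Longrightarrow> g p \<in> U \<Longrightarrow> axis_estimates \<phi> g lam gam p"
    and multipliers: "lam * gam = -1"
begin

lemma multipliers_squared: "lam^2 * gam^2 = 1"
  by (simp add: multipliers flip: power_mult_distrib)

lemma vertical_axis_invariant:
  assumes "\<phi> p $ 1 = 0" "p \<in> U" "g p \<in> U" shows "\<phi> (g p) $ 1 = 0"
proof -
  have "(\<lambda>p. \<phi> (g p) $ 1 - lam * \<phi> p $ 1) \<in> O[nhds p](\<lambda>p. (\<phi> p $ 1)^3 * (\<phi> p $ 2)^2)"
    using estimates[OF assms(2,3)] by (simp add: axis_estimates_def)
  from bigo_at_point[OF this] assms(1) show ?thesis by simp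
qed

text \<open>\<open>d x\<^sup>+\<close>, \<open>a c\<close>, \<open>f\<^sub>2\<^sub>0 x\<^sup>+\<close>, \<open>b c\<close> and \<open>f\<^sub>1\<^sub>1 x\<^sup>+\<close> are each multiplied by \<open>\<lambda> \<gamma>\<close>, so \<open>I\<close> and \<open>J\<close> are multiplied
by \<open>(\<lambda> \<gamma>)\<^sup>2 = 1\<close>.\<close>

lemma invariants_after_local_map:
  assumes "jet_with_invariants \<phi> F M N I J" "M \<in> U" "N \<in> U" "g N \<in> U" "(F \<longlongrightarrow> N) (nhds M)"
  shows "jet_with_invariants \<phi> (g \<circ> F) M (g N) I J"
proof -
  obtain a b c d s t where jet: "transition_jet \<phi> F M N a b c d s t"
    and I: "I = d * \<phi> N $ 1 * (a * c + s * \<phi> N $ 1)" and J: "J = b * c * t * \<phi> N $ 1"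
    using assms(1) by (auto simp: jet_with_invariants_def)
  note step = jet_after_local_map[OF jet estimates[OF assms(3,4)] assms(5)
      chart_tendsto[OF chart assms(2)] chart_tendsto[OF chart assms(3)]]
  have "I = (lam^2 * gam^2) * I" "J = (lam^2 * gam^2) * J" using multipliers_squared by simp_all
  then have "I = gam * d * \<phi> (g N) $ 1 * (lam * a * (gam * c) + gam * s * \<phi> (g N) $ 1)"
    "J = lam * b * (gam * c) * (gam * t) * \<phi> (g N) $ 1"
    unfolding step(2) I J by (simp_all add: algebra_simps power2_eq_square)
  with step(1) show ?thesis unfolding jet_with_invariants_def by blast
qed

text \<open>Now \<open>d\<close> is multiplied by \<open>\<gamma>\<^sup>2\<close>, \<open>a c\<close> and \<open>f\<^sub>2\<^sub>0\<close> by \<open>\<lambda>\<^sup>2\<close>, \<open>b c\<close> and \<open>f\<^sub>1\<^sub>1\<close> by \<open>\<lambda> \<gamma>\<close>; again \<open>I\<close> and \<open>J\<close> are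
multiplied by \<open>(\<lambda> \<gamma>)\<^sup>2\<close>.\<close>

lemma invariants_before_local_map:
  assumes "jet_with_invariants \<phi> F (g P) N I J" "P \<in> U" "g P \<in> U" "\<phi> P $ 1 = 0"
  shows "jet_with_invariants \<phi> (F \<circ> g) P N I J"
proof -
  obtain a b c d s t where jet: "transition_jet \<phi> F (g P) N a b c d s t"
    and I: "I = d * \<phi> N $ 1 * (a * c + s * \<phi> N $ 1)" and J: "J = b * c * t * \<phi> N $ 1"
    using assms(1) by (auto simp: jet_with_invariants_def)
  note step = jet_before_local_map[OF jet estimates[OF assms(2,3)] continuous_tendsto_nhds[OF cont] assms(4)
      chart_tendsto[OF chart assms(2)]]
  have "I = (lam^2 * gam^2) * I" "J = (lam^2 * gam^2) * J" using multipliers_squared by simp_all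
  then have "I = gam^2 * d * \<phi> N $ 1 * (lam * a * (lam * c) + lam^2 * s * \<phi> N $ 1)"
    "J = gam * b * (lam * c) * (lam * gam * t) * \<phi> N $ 1"
    unfolding I J by (simp_all add: algebra_simps power2_eq_square)
  with step show ?thesis unfolding jet_with_invariants_def by blast
qed

lemma invariants_after_local_iterates:
  assumes "jet_with_invariants \<phi> F M N I J" "M \<in> U" "continuous_on UNIV F"
    and "\<And>i. i \<le> n \<Longrightarrow> (g ^^ i) N \<in> U"
  shows "jet_with_invariants \<phi> (g ^^ n \<circ> F) M ((g ^^ n) N) I J"
  using assms(4)
proof (induction n)
  case 0
  then show ?case using assms(1) by simp
next
  case (Suc n)
  have FM: "F M = N" using assms(1) by (auto simp: jet_with_invariants_def transition_jet_def)
  have "continuous_on UNIV (g ^^ n \<circ> F)"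
    by (rule continuous_on_compose[OF assms(3) continuous_on_subset[OF continuous_funpow[OF cont] subset_UNIV]])
  then have "((g ^^ n \<circ> F) \<longlongrightarrow> (g ^^ n) N) (nhds M)"
    using continuous_tendsto_nhds[of "g ^^ n \<circ> F" M] FM by simp
  moreover have "jet_with_invariants \<phi> (g ^^ n \<circ> F) M ((g ^^ n) N) I J"
    by (rule Suc.IH) (use Suc.prems in simp)
  ultimately have "jet_with_invariants \<phi> (g \<circ> (g ^^ n \<circ> F)) M (g ((g ^^ n) N)) I J"
    using invariants_after_local_map[OF _ assms(2)] Suc.prems[of n] Suc.prems[of "Suc n"] by simp
  then show ?case by (simp add: comp_def)
qed

text \<open>Only \<open>P\<close> is assumed to lie on the vertical axis. The points between \<open>P\<close> and \<open>(g ^^ n) P\<close> lie on it because the axis is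
invariant forwards; in a large disk a point mapped onto the axis need not lie on it.\<close>

lemma invariants_before_local_iterates:
  assumes "jet_with_invariants \<phi> F ((g ^^ n) P) N I J" "\<phi> P $ 1 = 0"
    and "\<And>i. i \<le> n \<Longrightarrow> (g ^^ i) P \<in> U"
  shows "jet_with_invariants \<phi> (F \<circ> g ^^ n) P N I J"
  using assms(1,3)
proof (induction n arbitrary: F)
  case 0
  then show ?case by simp
next
  case (Suc n)
  have "\<phi> ((g ^^ i) P) $ 1 = 0" if "i \<le> n" for i
    using that
  proof (induction i)
    case (Suc i)
    then show ?case using vertical_axis_invariant Suc.prems Suc.IH \<open>\<And>i. i \<le> Suc n \<Longrightarrow> (g ^^ i) P \<in> U\<close>
      by (metis Suc_leD funpow.simps(2) comp_apply le_SucI)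
  qed (simp add: assms(2))
  then have "jet_with_invariants \<phi> (F \<circ> g) ((g ^^ n) P) N I J"
    using Suc.prems(1) Suc.prems(2)[of n] Suc.prems(2)[of "Suc n"]
    by (intro invariants_before_local_map) auto
  from Suc.IH[OF this] Suc.prems(2) show ?case by (simp add: comp_assoc)
qed

end

section \<open>From normalised coordinates and the normal form to expansions\<close>

lemma sign_change_isometry:
  assumes "\<sigma> \<in> {-1, 1}" "\<tau> \<in> {-1, 1::real}"
  shows "sign_change \<sigma> \<tau> (sign_change \<sigma> \<tau> v) = v"
    and "norm (sign_change \<sigma> \<tau> v) = norm v"
    and "sign_change \<sigma> \<tau> v - sign_change \<sigma> \<tau> w = sign_change \<sigma> \<tau> (v - w)"
proof -
  show "sign_change \<sigma> \<tau> (sign_change \<sigma> \<tau> v) = v"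
    using assms by (auto simp: sign_change_def vec_eq_iff forall_2)
  show "norm (sign_change \<sigma> \<tau> v) = norm v"
    using assms by (auto simp: sign_change_def norm_eq_sqrt_inner inner_vec_def UNIV_2)
  show "sign_change \<sigma> \<tau> v - sign_change \<sigma> \<tau> w = sign_change \<sigma> \<tau> (v - w)"
    by (simp add: sign_change_def vec_eq_iff forall_2 algebra_simps)
qed

lemma sign_change_tendsto: "(sign_change \<sigma> \<tau> \<longlongrightarrow> sign_change \<sigma> \<tau> w) (nhds w)"
proof (rule vec_tendstoI)
  fix i :: 2
  have c: "((\<lambda>v::real^2. v $ j) \<longlongrightarrow> w $ j) (nhds w)" for j
    by (rule tendsto_vec_nth) (simp add: filterlim_def)
  have "sign_change \<sigma> \<tau> v $ i = (if i = 1 then \<sigma> else \<tau>) * v $ i" for v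
    using exhaust_2[of i] by (auto simp: sign_change_def)
  then show "((\<lambda>v. sign_change \<sigma> \<tau> v $ i) \<longlongrightarrow> sign_change \<sigma> \<tau> w $ i) (nhds w)"
    using tendsto_mult[OF tendsto_const c] by simp
qed

text \<open>Expansions along \<open>at m\<close> leave out the base point; an exact value there makes them expansions along \<open>nhds m\<close>.\<close>

lemma smallo_at_imp_nhds:
  fixes u :: "'a::topological_space \<Rightarrow> real"
  assumes "u \<in> o[at m](v)" "u m = 0"
  shows "u \<in> o[nhds m](v)"
proof (rule landau_o.smallI)
  fix c :: real assume "c > 0"
  with assms(1) have "eventually (\<lambda>x. norm (u x) \<le> c * norm (v x)) (at m)"
    by (auto dest: landau_o.smallD)
  then have "eventually (\<lambda>x. x \<noteq> m \<longrightarrow> norm (u x) \<le> c * norm (v x)) (nhds m)"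
    by (simp add: eventually_at_filter)
  then show "eventually (\<lambda>x. norm (u x) \<le> c * norm (v x)) (nhds m)"
    by eventually_elim (use assms(2) \<open>c > 0\<close> in force)
qed

text \<open>\<open>I\<close> and \<open>J\<close> do not change under reflections of the coordinates: the reflection by \<open>(\<sigma>, \<tau>)\<close> multiplies \<open>b\<close> and \<open>c\<close> by
\<open>\<sigma> \<tau>\<close>, \<open>d\<close> and \<open>f\<^sub>2\<^sub>0\<close> by \<open>\<tau>\<close>, \<open>f\<^sub>1\<^sub>1\<close> and \<open>x\<^sup>+\<close> by \<open>\<sigma>\<close>. So they can be read off from the normalised coordinates of each pair
and compared in the unnormalised chart, which is the same for all pairs.\<close>

lemma global_map_invariants:
  fixes f :: "'a::t2_space \<Rightarrow> 'a"
  assumes chart: "is_chart (U0, \<phi>)" and cont: "continuous_on UNIV f"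
    and glob: "global_map f per z0 \<Gamma> U0 \<phi> Mp Mm q C"
  shows "jet_with_invariants \<phi> (f ^^ q) Mm Mp
      (cd C * xp C * (ca C * cc C + f20 C * xp C)) (cb C * cc C * f11 C * xp C)"
    and "\<phi> Mm $ 1 = 0" and "\<phi> Mp $ 2 = 0" and "\<phi> Mp $ 1 \<noteq> 0"
proof -
  define F where "F = f ^^ q"
  have FM: "F Mm = Mp" using glob by (simp add: global_map_def F_def)
  have Mp: "Mp \<in> U0" and Mm: "Mm \<in> U0"
    using glob by (auto simp: global_map_def local_stable_set_def dest: spec[where x=0])
  obtain \<sigma> \<tau> where st: "\<sigma> \<in> {-1, 1}" "\<tau> \<in> {-1, 1::real}"
    and rest: "let \<kappa> = sign_change \<sigma> \<tau> \<circ> \<phi>;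
            G = local_expr (U0, \<kappa>) (U0, \<kappa>) (f ^^ q);
            m = vector [0, ym C] :: real^2 in
          \<kappa> Mp = vector [xp C, 0] \<and> \<kappa> Mm = m \<and> xp C > 0 \<and> ym C > 0 \<and>
          (\<lambda>v. let x = v $ 1; h = v $ 2 - ym C in
             G v $ 1 - xp C - (ca C * x + cb C * h + e20 C * x^2 + e11 C * x * h + e02 C * h^2))
            \<in> o[at m](\<lambda>v. (norm (v - m))^2) \<and>
          (\<lambda>v. let x = v $ 1; h = v $ 2 - ym C in
             G v $ 2 - (cc C * x + cd C * h^2 + f20 C * x^2 + f11 C * x * h))
            \<in> o[at m](\<lambda>v. (norm (v - m))^2)"
    using glob unfolding global_map_def by blast
  define \<kappa> where "\<kappa> = sign_change \<sigma> \<tau> \<circ> \<phi>"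
  define G where "G = local_expr (U0, \<kappa>) (U0, \<kappa>) F"
  define m where "m = (vector [0, ym C] :: real^2)"
  define R1 where "R1 = (\<lambda>v. G v $ 1 - xp C - (ca C * v $ 1 + cb C * (v $ 2 - ym C) + e20 C * (v $ 1)^2
      + e11 C * v $ 1 * (v $ 2 - ym C) + e02 C * (v $ 2 - ym C)^2))"
  define R2 where "R2 = (\<lambda>v. G v $ 2 - (cc C * v $ 1 + cd C * (v $ 2 - ym C)^2 + f20 C * (v $ 1)^2
      + f11 C * v $ 1 * (v $ 2 - ym C)))"
  have kMp: "\<kappa> Mp = vector [xp C, 0]" and kMm: "\<kappa> Mm = m" and pos: "xp C > 0"
    and R1: "R1 \<in> o[at m](\<lambda>v. (norm (v - m))^2)" and R2: "R2 \<in> o[at m](\<lambda>v. (norm (v - m))^2)"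
    using rest by (simp_all add: \<kappa>_def F_def G_def m_def R1_def R2_def Let_def)
  have ss: "\<sigma> * \<sigma> = 1" "\<tau> * \<tau> = 1" using st by auto
  have k: "\<kappa> p $ 1 = \<sigma> * \<phi> p $ 1" "\<kappa> p $ 2 = \<tau> * \<phi> p $ 2" for p
    by (simp_all add: \<kappa>_def sign_change_def)
  have phi: "\<phi> p $ 1 = \<sigma> * \<kappa> p $ 1" "\<phi> p $ 2 = \<tau> * \<kappa> p $ 2" for p
    by (simp_all add: k ss flip: mult.assoc)
  have pMp: "\<phi> Mp $ 1 = \<sigma> * xp C" "\<phi> Mp $ 2 = 0" and pMm: "\<phi> Mm $ 1 = 0" "\<phi> Mm $ 2 = \<tau> * ym C"
    by (simp_all add: phi kMp kMm m_def)
  show "\<phi> Mm $ 1 = 0" "\<phi> Mp $ 2 = 0" "\<phi> Mp $ 1 \<noteq> 0" using pMp pMm pos st by auto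
  have op: "open U0" and inj\<phi>: "inj_on \<phi> U0"
    using chart by (auto simp: is_chart_def homeomorphism_def intro: inj_on_inverseI)
  have inj: "inj_on \<kappa> U0"
    using inj\<phi> sign_change_isometry(1)[OF st] unfolding \<kappa>_def
    by (intro comp_inj_on) (auto intro: inj_on_inverseI)
  have ev: "eventually (\<lambda>p. G (\<kappa> p) = \<kappa> (F p)) (nhds Mm)"
    using eventually_nhds_in_open[OF op Mm]
    by eventually_elim (simp add: G_def local_expr_def inv_into_f_f[OF inj])
  have GM: "G m = \<kappa> Mp"
    using eventually_nhds_x_imp_x[OF ev] by (simp add: kMm FM)
  note lim\<phi> = chart_tendsto[OF chart Mm]
  have lim: "(\<kappa> \<longlongrightarrow> m) (nhds Mm)"
    using filterlim_compose[OF sign_change_tendsto lim\<phi>, of \<sigma> \<tau>]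
    unfolding kMm[symmetric] \<kappa>_def comp_def .
  have dist: "norm (\<kappa> p - m) = norm (\<phi> p - \<phi> Mm)" for p
    unfolding kMm[symmetric] \<kappa>_def comp_def sign_change_isometry(3)[OF st]
    by (rule sign_change_isometry(2)[OF st])
  have "m $ 1 = 0" "m $ 2 = ym C" by (simp_all add: m_def)
  then have "R1 m = 0" "R2 m = 0" by (simp_all add: R1_def R2_def GM kMp)
  then have nh: "R1 \<in> o[nhds m](\<lambda>v. (norm (v - m))^2)" "R2 \<in> o[nhds m](\<lambda>v. (norm (v - m))^2)"
    using R1 R2 by (auto intro: smallo_at_imp_nhds)
  have r1: "(\<lambda>p. R1 (\<kappa> p)) \<in> o[nhds Mm](\<lambda>p. (norm (\<phi> p - \<phi> Mm))^2)"
    using landau_o.small.compose[OF nh(1) lim] by (simp add: dist)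
  have r2: "(\<lambda>p. R2 (\<kappa> p)) \<in> o[nhds Mm](\<lambda>p. (norm (\<phi> p - \<phi> Mm))^2)"
    using landau_o.small.compose[OF nh(2) lim] by (simp add: dist)
  note quad = quadratic_terms_bigo[OF lim\<phi> pMm(1), of "\<sigma> * e20 C" "\<tau> * e11 C" "\<sigma> * e02 C"]
  have a: "(\<lambda>p. \<sigma> * R1 (\<kappa> p) + (\<sigma> * e20 C * (\<phi> p $ 1)^2 + \<tau> * e11 C * (\<phi> p $ 1 * (\<phi> p $ 2 - \<phi> Mm $ 2))
      + \<sigma> * e02 C * (\<phi> p $ 2 - \<phi> Mm $ 2)^2)) \<in> O[nhds Mm](\<lambda>p. (norm (\<phi> p - \<phi> Mm))^2)"
    by (rule sum_in_bigo(1)[OF _ quad]) (use landau_o.small_imp_big[OF r1] in simp)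
  have "eventually (\<lambda>p. \<sigma> * R1 (\<kappa> p) + (\<sigma> * e20 C * (\<phi> p $ 1)^2 + \<tau> * e11 C * (\<phi> p $ 1 * (\<phi> p $ 2 - \<phi> Mm $ 2))
      + \<sigma> * e02 C * (\<phi> p $ 2 - \<phi> Mm $ 2)^2)
      = \<phi> (F p) $ 1 - \<phi> Mp $ 1 - (ca C * \<phi> p $ 1 + \<sigma> * \<tau> * cb C * (\<phi> p $ 2 - \<phi> Mm $ 2))) (nhds Mm)"
    using ev
  proof eventually_elim
    case (elim p)
    have h: "\<tau> * \<phi> p $ 2 - ym C = \<tau> * (\<phi> p $ 2 - \<phi> Mm $ 2)"
      using st by (auto simp: pMm algebra_simps)
    show ?case
      unfolding R1_def elim k h pMp(1) using st by (auto simp: algebra_simps power2_eq_square)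
  qed
  from iffD1[OF landau_o.big.in_cong[OF this] a]
  have jet1: "(\<lambda>p. \<phi> (F p) $ 1 - \<phi> Mp $ 1 - (ca C * \<phi> p $ 1 + \<sigma> * \<tau> * cb C * (\<phi> p $ 2 - \<phi> Mm $ 2)))
    \<in> O[nhds Mm](\<lambda>p. (norm (\<phi> p - \<phi> Mm))^2)" .
  have b: "(\<lambda>p. \<tau> * R2 (\<kappa> p)) \<in> o[nhds Mm](\<lambda>p. (norm (\<phi> p - \<phi> Mm))^2)"
    using r2 by simp
  have "eventually (\<lambda>p. \<tau> * R2 (\<kappa> p) = \<phi> (F p) $ 2 - (\<sigma> * \<tau> * cc C * \<phi> p $ 1
      + \<tau> * cd C * (\<phi> p $ 2 - \<phi> Mm $ 2)^2 + \<tau> * f20 C * (\<phi> p $ 1)^2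
            + \<sigma> * f11 C * \<phi> p $ 1 * (\<phi> p $ 2 - \<phi> Mm $ 2))) (nhds Mm)"
    using ev
  proof eventually_elim
    case (elim p)
    have h: "\<tau> * \<phi> p $ 2 - ym C = \<tau> * (\<phi> p $ 2 - \<phi> Mm $ 2)"
      using st by (auto simp: pMm algebra_simps)
    show ?case
      unfolding R2_def elim k h using st by (auto simp: algebra_simps power2_eq_square)
  qed
  from iffD1[OF landau_o.small.in_cong[OF this] b] jet1
  have "transition_jet \<phi> F Mm Mp (ca C) (\<sigma> * \<tau> * cb C) (\<sigma> * \<tau> * cc C) (\<tau> * cd C) (\<tau> * f20 C) (\<sigma> * f11 C)"
    using FM pMp(2) pMm(1) by (simp add: transition_jet_def)
  moreover have "cd C * xp C * (ca C * cc C + f20 C * xp C)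
      = \<tau> * cd C * \<phi> Mp $ 1 * (ca C * (\<sigma> * \<tau> * cc C) + \<tau> * f20 C * \<phi> Mp $ 1)"
    "cb C * cc C * f11 C * xp C = \<sigma> * \<tau> * cb C * (\<sigma> * \<tau> * cc C) * (\<sigma> * f11 C) * \<phi> Mp $ 1"
    using st by (auto simp: pMp algebra_simps)
  ultimately show "jet_with_invariants \<phi> (f ^^ q) Mm Mp
      (cd C * xp C * (ca C * cc C + f20 C * xp C)) (cb C * cc C * f11 C * xp C)"
    unfolding jet_with_invariants_def F_def by blast
qed

text \<open>The remainders are the resonant monomials \<open>x\<^sup>3 y\<^sup>2\<close> and \<open>x\<^sup>2 y\<^sup>3\<close> times the factor \<open>\<bar>x\<bar> + \<bar>y\<bar>\<close>. Near any given point this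
factor is bounded, so that resonant terms and remainders satisfy one common estimate.\<close>

lemma normal_form_axis_estimates:
  fixes f :: "'a::t2_space \<Rightarrow> 'a"
  assumes nf: "normal_form_coords A f per z0 lam gam U0 \<phi>"
    and p: "p \<in> U0" "(f ^^ per) p \<in> U0" and cont: "continuous_on UNIV f"
  shows "axis_estimates \<phi> (f ^^ per) lam gam p"
proof -
  define g where "g = f ^^ per"
  define X where "X = (\<lambda>p. \<phi> p $ 1)"
  define Y where "Y = (\<lambda>p. \<phi> p $ 2)"
  have chart: "is_chart (U0, \<phi>)" using nf by (simp add: normal_form_coords_def)
  have op: "open U0" and inj: "inj_on \<phi> U0"
    using chart by (auto simp: is_chart_def homeomorphism_def intro: inj_on_inverseI)
  obtain B K where est: "\<forall>v \<in> local_dom (U0, \<phi>) (U0, \<phi>) (f ^^ per).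
        let x = v $ 1; y = v $ 2; w = local_expr (U0, \<phi>) (U0, \<phi>) (f ^^ per) v in
          \<bar>w $ 1 - lam * x * (1 + B * (x * y)^2)\<bar> \<le> K * (\<bar>x\<bar>^3 * \<bar>y\<bar>^2 * (\<bar>x\<bar> + \<bar>y\<bar>)) \<and>
          \<bar>w $ 2 - gam * y * (1 - B * (x * y)^2)\<bar> \<le> K * (\<bar>x\<bar>^2 * \<bar>y\<bar>^3 * (\<bar>x\<bar> + \<bar>y\<bar>))"
    using nf unfolding normal_form_coords_def by blast
  have pt: "\<bar>X (g z) - lam * X z * (1 + B * (X z * Y z)^2)\<bar> \<le> K * (\<bar>X z\<bar>^3 * \<bar>Y z\<bar>^2 * (\<bar>X z\<bar> + \<bar>Y z\<bar>)) \<and>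
      \<bar>Y (g z) - gam * Y z * (1 - B * (X z * Y z)^2)\<bar> \<le> K * (\<bar>X z\<bar>^2 * \<bar>Y z\<bar>^3 * (\<bar>X z\<bar> + \<bar>Y z\<bar>))"
    if "z \<in> U0" "g z \<in> U0" for z
  proof -
    have "\<phi> z \<in> local_dom (U0, \<phi>) (U0, \<phi>) (f ^^ per)" using that by (auto simp: local_dom_def g_def)
    from bspec[OF est this] show ?thesis
      by (simp add: Let_def local_expr_def inv_into_f_f[OF inj that(1)] X_def Y_def g_def)
  qed
  have "(\<phi> \<longlongrightarrow> \<phi> p) (nhds p)"
    by (rule chart_tendsto[OF chart p(1)])
  then have lim: "(X \<longlongrightarrow> X p) (nhds p)" "(Y \<longlongrightarrow> Y p) (nhds p)"
    unfolding X_def Y_def by (auto intro: tendsto_vec_nth)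
  have size: "((\<lambda>z. \<bar>X z\<bar> + \<bar>Y z\<bar>) \<longlongrightarrow> \<bar>X p\<bar> + \<bar>Y p\<bar>) (nhds p)"
    by (intro tendsto_intros lim)
  define S where "S = \<bar>X p\<bar> + \<bar>Y p\<bar> + 1"
  have evS: "eventually (\<lambda>z. \<bar>X z\<bar> + \<bar>Y z\<bar> < S) (nhds p)"
    by (rule order_tendstoD(2)[OF size]) (simp add: S_def)
  have glim: "(g \<longlongrightarrow> g p) (nhds p)"
    unfolding g_def by (rule continuous_tendsto_nhds[OF continuous_funpow[OF cont]])
  have evU: "eventually (\<lambda>z. z \<in> U0 \<and> g z \<in> U0) (nhds p)"
    using eventually_nhds_in_open[OF op p(1)] topological_tendstoD[OF glim op] p(2)
    by (auto simp: g_def intro: eventually_conj)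
  \<comment> \<open>\<open>W\<close> is the monomial, \<open>e\<close> the resonant term and \<open>s\<close> the extra factor \<open>\<bar>x\<bar> + \<bar>y\<bar>\<close> of the remainder, bounded by \<open>S\<close>\<close>
  have bound: "\<bar>r\<bar> \<le> (\<bar>m * B\<bar> + \<bar>K\<bar> * S) * W"
    if "\<bar>r - e\<bar> \<le> K * (W * s)" "\<bar>e\<bar> = \<bar>m * B\<bar> * W" "0 \<le> W" "0 \<le> s" "s \<le> S" for r e m W s
  proof -
    have "K * (W * s) \<le> \<bar>K\<bar> * (W * S)"
      using that by (intro mult_mono mult_left_mono) auto
    with that(1,2) show ?thesis by (simp add: algebra_simps)
  qed
  have "(\<lambda>z. X (g z) - lam * X z) \<in> O[nhds p](\<lambda>z. X z ^ 3 * Y z ^ 2)"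
  proof (rule bigoI[where c = "\<bar>lam * B\<bar> + \<bar>K\<bar> * S"])
    show "eventually (\<lambda>z. norm (X (g z) - lam * X z)
        \<le> (\<bar>lam * B\<bar> + \<bar>K\<bar> * S) * norm (X z ^ 3 * Y z ^ 2)) (nhds p)"
      using evS evU
    proof eventually_elim
      case (elim z)
      have eq: "X (g z) - lam * X z * (1 + B * (X z * Y z)^2)
          = X (g z) - lam * X z - lam * B * (X z ^ 3 * Y z ^ 2)"
        by (simp add: algebra_simps power2_eq_square power3_eq_cube)
      have "\<bar>X (g z) - lam * X z - lam * B * (X z ^ 3 * Y z ^ 2)\<bar>
          \<le> K * (\<bar>X z ^ 3 * Y z ^ 2\<bar> * (\<bar>X z\<bar> + \<bar>Y z\<bar>))"
        unfolding eq[symmetric] using pt[of z] elim by (simp add: abs_mult power_abs)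
      then show ?case
        unfolding real_norm_def by (rule bound) (use elim in \<open>auto simp: abs_mult\<close>)
    qed
  qed
  moreover have "(\<lambda>z. Y (g z) - gam * Y z) \<in> O[nhds p](\<lambda>z. X z ^ 2 * Y z ^ 3)"
  proof (rule bigoI[where c = "\<bar>gam * B\<bar> + \<bar>K\<bar> * S"])
    show "eventually (\<lambda>z. norm (Y (g z) - gam * Y z)
        \<le> (\<bar>gam * B\<bar> + \<bar>K\<bar> * S) * norm (X z ^ 2 * Y z ^ 3)) (nhds p)"
      using evS evU
    proof eventually_elim
      case (elim z)
      have eq: "Y (g z) - gam * Y z * (1 - B * (X z * Y z)^2)
          = Y (g z) - gam * Y z - - (gam * B * (X z ^ 2 * Y z ^ 3))"
        by (simp add: algebra_simps power2_eq_square power3_eq_cube)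
      have "\<bar>Y (g z) - gam * Y z - - (gam * B * (X z ^ 2 * Y z ^ 3))\<bar>
          \<le> K * (\<bar>X z ^ 2 * Y z ^ 3\<bar> * (\<bar>X z\<bar> + \<bar>Y z\<bar>))"
        unfolding eq[symmetric] using pt[of z] elim by (simp add: abs_mult power_abs)
      then show ?case
        unfolding real_norm_def by (rule bound) (use elim in \<open>auto simp: abs_mult\<close>)
    qed
  qed
  ultimately show ?thesis by (simp add: axis_estimates_def X_def Y_def g_def)
qed

section \<open>Points of the homoclinic orbit on the local manifolds\<close>

lemma full_orbit_related:
  assumes "bij f" "M \<in> full_orbit f p" "M' \<in> full_orbit f p"
  shows "\<exists>k. M' = (f ^^ k) M \<or> M = (f ^^ k) M'"
proof -
  have inv: "(f ^^ k) ((inv f ^^ k) x) = x" for k x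
    using assms(1) by (metis bij_fn bij_inv_eq_iff inv_fn)
  have base: "\<exists>i j. (f ^^ i) x = (f ^^ j) p" if "x \<in> full_orbit f p" for x
    using that
  proof (unfold full_orbit_def, elim UnE rangeE)
    fix k assume "x = (f ^^ k) p"
    then show ?thesis by (intro exI[of _ 0] exI[of _ k]) simp
  next
    fix k assume "x = (inv f ^^ k) p"
    then show ?thesis using inv by (intro exI[of _ k] exI[of _ 0]) simp
  qed
  obtain i j where ij: "(f ^^ i) M = (f ^^ j) p" using base[OF assms(2)] by blast
  obtain i' j' where ij': "(f ^^ i') M' = (f ^^ j') p" using base[OF assms(3)] by blast
  have "(f ^^ (j' + i)) M = (f ^^ (j + i')) M'"
    using ij ij' by (simp add: funpow_add) (metis add.commute comp_apply funpow_add)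
  moreover have "x = (f ^^ (n - m)) y" if "(f ^^ m) x = (f ^^ n) y" "m \<le> n" for m n x y
  proof -
    have "(f ^^ m) x = (f ^^ m) ((f ^^ (n - m)) y)"
      using that by (simp flip: comp_apply[of "f ^^ m"] funpow_add)
    then show ?thesis using bij_is_inj[OF bij_fn[OF assms(1)]] by (simp add: inj_eq)
  qed
  ultimately show ?thesis by (metis nat_le_linear)
qed

text \<open>Limits are unique, and \<open>f ^^ k\<close> carries the \<open>h\<close>-orbit of \<open>M\<close> to that of \<open>(f ^^ k) M\<close>. For \<open>h\<close> the local map or its inverse
this makes the shift \<open>k\<close> between two points on one local manifold a multiple of the period, so that they differ by
iterates of the local map.\<close>

lemma periodic_shift:
  fixes f h :: "'a::t2_space \<Rightarrow> 'a"
  assumes cont: "continuous_on UNIV f" and comm: "\<And>x. h (f x) = f (h x)"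
    and M: "M \<in> stable_set h z0" "(f ^^ k) M \<in> stable_set h z0"
  shows "(f ^^ k) z0 = z0"
proof -
  have f: "h ((f ^^ k) x) = (f ^^ k) (h x)" for x by (induction k) (simp_all add: comm)
  have eq: "(h ^^ n) ((f ^^ k) M) = (f ^^ k) ((h ^^ n) M)" for n
    by (induction n) (simp_all add: f)
  have "(\<lambda>n. (h ^^ n) M) \<longlonglongrightarrow> z0" using M(1) by (simp add: stable_set_def)
  then have "(\<lambda>n. (f ^^ k) ((h ^^ n) M)) \<longlonglongrightarrow> (f ^^ k) z0"
    using continuous_tendsto_nhds[OF continuous_funpow[OF cont]] filterlim_compose by blast
  moreover have "(\<lambda>n. (f ^^ k) ((h ^^ n) M)) \<longlonglongrightarrow> z0" using M(2) by (simp add: stable_set_def eq)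
  ultimately show ?thesis using LIMSEQ_unique by blast
qed

lemma minimal_period_dvd:
  assumes "(f ^^ per) z = z" "\<forall>k. 0 < k \<and> k < per \<longrightarrow> (f ^^ k) z \<noteq> z" "per \<ge> 1" "(f ^^ k) z = z"
  shows "per dvd k"
proof -
  have fixed: "(f ^^ (k mod per)) z = z" using funpow_mod_eq[OF assms(1), of k] assms(4) by simp
  have "\<not> 0 < k mod per"
  proof
    assume "0 < k mod per"
    moreover have "k mod per < per" using assms(3) by simp
    ultimately have "(f ^^ (k mod per)) z \<noteq> z" by (intro assms(2)[rule_format] conjI)
    from this fixed show False by (rule notE)
  qed
  then show ?thesis by (simp add: dvd_eq_mod_eq_0)
qed

lemma stable_points_share_iterate:
  fixes f h :: "'a::t2_space \<Rightarrow> 'a"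
  assumes "bij f" "continuous_on UNIV f" "\<And>x. h (f x) = f (h x)"
    and "(f ^^ per) z0 = z0" "\<forall>k. 0 < k \<and> k < per \<longrightarrow> (f ^^ k) z0 \<noteq> z0" "per \<ge> 1"
    and "M \<in> full_orbit f p" "M' \<in> full_orbit f p" "M \<in> stable_set h z0" "M' \<in> stable_set h z0"
  shows "\<exists>n. M' = ((f ^^ per) ^^ n) M \<or> M = ((f ^^ per) ^^ n) M'"
proof -
  obtain k where k: "M' = (f ^^ k) M \<or> M = (f ^^ k) M'"
    using full_orbit_related[OF assms(1,7,8)] by blast
  then have "(f ^^ k) z0 = z0"
    using periodic_shift[OF assms(2,3) assms(9), of k] periodic_shift[OF assms(2,3) assms(10), of k] assms(9,10)
    by auto
  then obtain n where "k = per * n" using minimal_period_dvd[OF assms(4,5,6)] by (auto elim: dvdE)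
  with k show ?thesis by (auto simp: funpow_mult mult.commute)
qed

lemma stable_point_not_periodic:
  fixes g :: "'a::t2_space \<Rightarrow> 'a"
  assumes "N \<in> stable_set g z0" "(g ^^ s) N = N" "s > 0"
  shows "N = z0"
proof -
  have "((g ^^ s) ^^ n) N = N" for n by (induction n) (simp_all add: assms(2))
  then have const: "(g ^^ (s * n)) N = N" for n by (simp add: funpow_mult)
  have "strict_mono (\<lambda>n. s * n)" using assms(3) by (simp add: strict_mono_def)
  with assms(1) have "((\<lambda>n. (g ^^ n) N) \<circ> (\<lambda>n. s * n)) \<longlonglongrightarrow> z0"
    by (intro LIMSEQ_subseq_LIMSEQ) (simp_all add: stable_set_def)
  then have "(\<lambda>n. N) \<longlonglongrightarrow> z0" by (simp add: comp_def const)
  then show ?thesis using LIMSEQ_unique tendsto_const by blast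
qed

text \<open>Of the two points take the one that is later on the orbit; both points reach it without leaving the disk.\<close>

lemma common_forward_point:
  assumes "M' = (g ^^ n) M \<or> M = (g ^^ n) M'"
    and "M \<in> local_stable_set g z0 U" "M' \<in> local_stable_set g z0 U"
  obtains i j N where "N = (g ^^ i) M" "N = (g ^^ j) M'" "N \<in> {M, M'}"
    "\<And>l. (g ^^ l) M \<in> U" "\<And>l. (g ^^ l) M' \<in> U"
  using assms(1)
proof
  assume "M' = (g ^^ n) M" then show thesis
    using assms(2,3) that[of M' n 0] by (auto simp: local_stable_set_def)
next
  assume "M = (g ^^ n) M'" then show thesis
    using assms(2,3) that[of M 0 n] by (auto simp: local_stable_set_def)
qed

text \<open>Of the two points take the one that is earlier on the orbit. Its forward iterates up to the later one are backward iterates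
of the later one, hence stay in the disk.\<close>

lemma common_backward_point:
  assumes "bij g" "M' = (g ^^ n) M \<or> M = (g ^^ n) M'"
    and "M \<in> local_unstable_set g z0 U" "M' \<in> local_unstable_set g z0 U"
  obtains i j P where "(g ^^ i) P = M" "(g ^^ j) P = M'" "P \<in> {M, M'}"
    "\<And>l. l \<le> i \<Longrightarrow> (g ^^ l) P \<in> U" "\<And>l. l \<le> j \<Longrightarrow> (g ^^ l) P \<in> U"
proof -
  have earlier: "(g ^^ l) P \<in> U" if "(g ^^ m) P \<in> local_unstable_set g z0 U" "l \<le> m" for l m P
  proof -
    have "(inv g ^^ k) ((g ^^ k) x) = x" for k x
      using assms(1) by (metis bij_fn bij_is_inj inv_f_f inv_fn)
    moreover have "(g ^^ m) P = (g ^^ (m - l)) ((g ^^ l) P)"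
      using that(2) by (simp flip: comp_apply[of "g ^^ (m - l)"] funpow_add)
    ultimately have "(inv g ^^ (m - l)) ((g ^^ m) P) = (g ^^ l) P" by simp
    with that(1) show ?thesis by (auto simp: local_stable_set_def dest: spec[where x="m - l"])
  qed
  from assms(2) show thesis
  proof
    assume "M' = (g ^^ n) M" then show thesis
      using earlier[of 0 M] earlier[of n M] assms(3,4) by (intro that[of 0 M n]) auto
  next
    assume "M = (g ^^ n) M'" then show thesis
      using earlier[of 0 M'] earlier[of n M'] assms(3,4) by (intro that[of n M' 0]) auto
  qed
qed

section \<open>Independence of the pair of homoclinic points\<close>

theorem lemma8:
  fixes A :: "'a::{t2_space, second_countable_topology} chart set"
    and \<rho> :: "'a chart \<Rightarrow> real^2 \<Rightarrow> real"
    and r per q q' :: nat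
    and f\<^sub>0 :: "'a \<Rightarrow> 'a"
    and z0 Mp Mm Mp' Mm' :: 'a
    and U0 \<Gamma>\<^sub>0 :: "'a set"
    and \<phi> :: "'a \<Rightarrow> real^2"
    and lam gam \<nu>\<^sub>1 :: real
    and C C' :: global_coeffs
  assumes "f\<^sub>0 \<in> H32 r A \<rho> per z0 lam gam \<Gamma>\<^sub>0 \<union> H33 r A \<rho> per z0 lam gam \<Gamma>\<^sub>0"
    and "normal_form_coords A f\<^sub>0 per z0 lam gam U0 \<phi>"
    and "\<nu>\<^sub>1 \<in> {-1, 1}"
    and "global_map f\<^sub>0 per z0 \<Gamma>\<^sub>0 U0 \<phi> Mp Mm q C" and "needed_type C"
    and "global_map f\<^sub>0 per z0 \<Gamma>\<^sub>0 U0 \<phi> Mp' Mm' q' C'" and "needed_type C'"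
  shows "s0 \<nu>\<^sub>1 C = s0 \<nu>\<^sub>1 C'"
proof -
  define g where "g = f\<^sub>0 ^^ per"
  have setting: "homoclinic_setting r A \<rho> per z0 lam gam \<Gamma>\<^sub>0 f\<^sub>0" and lg: "lam = - inverse gam" "lam < 0"
    using assms(1) by (auto simp: H32_def H33_def)
  have bij: "bij f\<^sub>0" and continuous: "continuous_on UNIV f\<^sub>0"
    and per: "per \<ge> 1" "(f\<^sub>0 ^^ per) z0 = z0" "\<forall>k. 0 < k \<and> k < per \<longrightarrow> (f\<^sub>0 ^^ k) z0 \<noteq> z0"
    using setting by (auto simp: homoclinic_setting_def area_preserving_def saddle_point_def)
  obtain p where \<Gamma>: "\<Gamma>\<^sub>0 = full_orbit f\<^sub>0 p"
    using setting by (auto simp: homoclinic_setting_def tangent_homoclinic_orbit_def Let_def)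
  have chart: "is_chart (U0, \<phi>)" and \<phi>z0: "\<phi> z0 = 0"
    using assms(2) by (simp_all add: normal_form_coords_def)
  interpret local_saddle_map U0 \<phi> g lam gam
  proof
    show "continuous_on UNIV g" unfolding g_def by (rule continuous_funpow[OF continuous])
    show "lam * gam = -1" using lg by (cases "gam = 0") auto
  qed (use chart normal_form_axis_estimates[OF assms(2) _ _ continuous] in \<open>auto simp: g_def\<close>)
  have bijg: "bij g" unfolding g_def by (rule bij_fn[OF bij])
  have Mp: "Mp \<in> \<Gamma>\<^sub>0" "Mp' \<in> \<Gamma>\<^sub>0" "Mp \<in> local_stable_set g z0 U0" "Mp' \<in> local_stable_set g z0 U0"
    and Mm: "Mm \<in> \<Gamma>\<^sub>0" "Mm' \<in> \<Gamma>\<^sub>0" "Mm \<in> local_unstable_set g z0 U0" "Mm' \<in> local_unstable_set g z0 U0"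
    and q: "(f\<^sub>0 ^^ q) Mm = Mp" "(f\<^sub>0 ^^ q') Mm' = Mp'"
    using assms(4,6) by (auto simp: global_map_def g_def)
  note jet = global_map_invariants[OF chart continuous assms(4)]
  note jet' = global_map_invariants[OF chart continuous assms(6)]
  have comm: "g (f\<^sub>0 x) = f\<^sub>0 (g x)" for x unfolding g_def by (metis funpow_swap1)
  have comm': "inv g (f\<^sub>0 x) = f\<^sub>0 (inv g x)" for x
    using comm[of "inv g x"] bijg by (metis bij_inv_eq_iff)
  have stable: "Mp \<in> stable_set g z0" "Mp' \<in> stable_set g z0"
    and unstable: "Mm \<in> unstable_set g z0" "Mm' \<in> unstable_set g z0"
    using Mp Mm by (simp_all add: local_stable_set_def)
  obtain n where n: "Mp' = (g ^^ n) Mp \<or> Mp = (g ^^ n) Mp'"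
    using stable_points_share_iterate[OF bij continuous comm per(2,3,1) Mp(1,2)[unfolded \<Gamma>] stable]
    by (auto simp: g_def)
  obtain n' where n': "Mm' = (g ^^ n') Mm \<or> Mm = (g ^^ n') Mm'"
    using stable_points_share_iterate[OF bij continuous comm' per(2,3,1) Mm(1,2)[unfolded \<Gamma>] unstable]
    by (auto simp: g_def)
  \<comment> \<open>both pairs are moved to the later of the two points \<open>M\<^sup>+\<close> and the earlier of the two points \<open>M\<^sup>-\<close>, so that only forward iterates of the local map occur\<close>
  obtain i i' N where N: "N = (g ^^ i) Mp" "N = (g ^^ i') Mp'" "N \<in> {Mp, Mp'}"
    and NU: "\<And>l. (g ^^ l) Mp \<in> U0" "\<And>l. (g ^^ l) Mp' \<in> U0"
    by (rule common_forward_point[OF n Mp(3,4)]) blast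
  obtain j j' P where P: "(g ^^ j) P = Mm" "(g ^^ j') P = Mm'" "P \<in> {Mm, Mm'}"
    and PU: "\<And>l. l \<le> j \<Longrightarrow> (g ^^ l) P \<in> U0" "\<And>l. l \<le> j' \<Longrightarrow> (g ^^ l) P \<in> U0"
    by (rule common_backward_point[OF bijg n' Mm(3,4)]) blast
  have axis: "\<phi> P $ 1 = 0" using P(3) jet(2) jet'(2) by auto
  have power: "g ^^ a \<circ> (f\<^sub>0 ^^ b) \<circ> g ^^ c = f\<^sub>0 ^^ (per * a + b + per * c)" for a b c
    by (simp add: g_def funpow_mult funpow_add mult.commute)
  have moved: "jet_with_invariants \<phi> (f\<^sub>0 ^^ (per * a + b + per * c)) P ((g ^^ a) M) I J"
    if "jet_with_invariants \<phi> (f\<^sub>0 ^^ b) ((g ^^ c) P) M I J"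
      "\<And>l. (g ^^ l) M \<in> U0" "\<And>l. l \<le> c \<Longrightarrow> (g ^^ l) P \<in> U0" for a b c M I J
  proof -
    have "jet_with_invariants \<phi> (g ^^ a \<circ> f\<^sub>0 ^^ b) ((g ^^ c) P) ((g ^^ a) M) I J"
      using that by (intro invariants_after_local_iterates continuous_funpow[OF continuous]) auto
    then show ?thesis
      using invariants_before_local_iterates[OF _ axis, of "g ^^ a \<circ> f\<^sub>0 ^^ b" c] that(3) power by simp
  qed
  define Q where "Q = per * i + q + per * j"
  define Q' where "Q' = per * i' + q' + per * j'"
  have m: "jet_with_invariants \<phi> (f\<^sub>0 ^^ Q) P N (cd C * xp C * (ca C * cc C + f20 C * xp C)) (cb C * cc C * f11 C * xp C)"
    using moved[of q j Mp] jet(1) NU(1) PU(1) P(1) by (simp add: Q_def N(1))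
  have m': "jet_with_invariants \<phi> (f\<^sub>0 ^^ Q') P N (cd C' * xp C' * (ca C' * cc C' + f20 C' * xp C')) (cb C' * cc C' * f11 C' * xp C')"
    using moved[of q' j' Mp'] jet'(1) NU(2) PU(2) P(2) by (simp add: Q'_def N(2))
  have QN: "(f\<^sub>0 ^^ Q) P = N" "(f\<^sub>0 ^^ Q') P = N"
    using m m' by (auto simp: jet_with_invariants_def transition_jet_def)
  have Nz: "N \<in> stable_set g z0" "N \<noteq> z0"
    using N(3) stable jet(4) jet'(4) \<phi>z0 by auto
  \<comment> \<open>the orbit is not periodic, so its points determine the number of iterations between them and both global maps have become the same power of \<open>f\<^sub>0\<close>\<close>
  have no_return: "a = b" if "(f\<^sub>0 ^^ a) P = N" "(f\<^sub>0 ^^ b) P = N" "a \<le> b" for a b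
  proof (rule ccontr)
    assume "a \<noteq> b"
    define s where "s = b - a"
    have s: "s > 0" "b = s + a" using that(3) \<open>a \<noteq> b\<close> by (auto simp: s_def)
    have "(f\<^sub>0 ^^ s) N = N" using that(1,2) by (simp add: s(2) funpow_add)
    then have "((f\<^sub>0 ^^ s) ^^ n) N = N" for n by (induction n) simp_all
    from this[of per] have "(g ^^ s) N = N" by (simp add: g_def funpow_mult mult.commute)
    with stable_point_not_periodic[OF Nz(1) _ s(1)] Nz(2) show False by blast
  qed
  have "Q = Q'" using no_return[OF QN] no_return[OF QN(2,1)] by linarith
  with m m' have m'': "jet_with_invariants \<phi> (f\<^sub>0 ^^ Q) P N (cd C' * xp C' * (ca C' * cc C' + f20 C' * xp C')) (cb C' * cc C' * f11 C' * xp C')"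
    by simp
  have PU0: "P \<in> U0" using PU(1)[of 0] by simp
  \<comment> \<open>for pairs of the needed type \<open>J = - f\<^sub>1\<^sub>1 x\<^sup>+\<close>, and \<open>s\<^sub>0\<close> is a function of \<open>I\<close>, \<open>J\<close> and \<open>\<nu>\<^sub>1\<close>\<close>
  from jet_invariants_unique[OF chart PU0 m m''] assms(5,7)
  have "cd C * xp C * (ca C * cc C + f20 C * xp C) = cd C' * xp C' * (ca C' * cc C' + f20 C' * xp C')"
    "f11 C * xp C = f11 C' * xp C'"
    by (simp_all add: needed_type_def)
  then show ?thesis unfolding s0_def by (simp only: mult.assoc)
qed

end
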